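(* Let $Q(z)\in\mathbf{N}_1$ and assume that $Q(z)$ extends to a holomorphic function $\widetilde Q(z)$ in some simply connected neighborhood $\Omega$ of $z_0\in\mathbb{R}$. Furthermore assume that $\alpha(\tau_0)=z_0$ for some $\tau_0\in\mathbb{R}$, where $\alpha(\tau)$ denotes the generalized zero of nonpositive type of $Q_\tau(z)$. Then precisely one of the following cases occurs: (1) $\widetilde Q'(z_0)<0$. Then there exists $\varepsilon>0$ such that the function $\alpha(\tau)$ is holomorphic on $(\tau_0-\varepsilon,\tau_0+\varepsilon)$ and $$\lim_{\tau\uparrow\tau_0}\arg(\alpha(\tau)-z_0)=0,\qquad \lim_{\tau\downarrow\tau_0}\arg(\alpha(\tau)-z_0)=\pi.$$ (2) $\widetilde Q'(z_0)=0$ and $\widetilde Q''(z_0)\neq0$. Then there exist $\varepsilon_1>0$ and $\varepsilon_2>0$ such that the function $\alpha(\tau)$ is holomorphic on each of the intervals $(\tau_0-\varepsilon_1,\tau_0)$ and $(\tau_0,\tau_0+\varepsilon_2)$. Moreover, $$\lim_{\tau\downarrow\tau_0}\arg(\alpha(\tau)-z_0)=\frac{2\pi-\theta_0}{2},\qquad \lim_{\tau\uparrow\tau_0}\arg(\alpha(\tau)-z_0)=\frac{\pi-\theta_0}{2},$$ where $\theta_0=\arg\widetilde Q''(z_0)$. (3) $\widetilde Q'(z_0)=\widetilde Q''(z_0)=0$ and $\widetilde Q'''(z_0)\ne0$. Then there exist $\varepsilon_1>0$ and $\varepsilon_2>0$ such that the function $\alpha(\tau)$ is holomorphic on each of the intervals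 $(\tau_0-\varepsilon_1,\tau_0)$ and $(\tau_0,\tau_0+\varepsilon_2)$. Moreover, $$\lim_{\tau\uparrow\tau_0}\arg(\alpha(\tau)-z_0)=\frac{\pi}{3},\qquad \lim_{\tau\downarrow\tau_0}\arg(\alpha(\tau)-z_0)=\frac{2\pi}{3}.$$
   Context: $\mathbb{C}^+$ is the open upper half-plane. A Nevanlinna function is a function $M$ holomorphic on $\mathbb{C}\setminus\mathbb{R}$, with $\overline{M(z)}=M(\bar z)$, mapping $\mathbb{C}^+$ into $\mathbb{C}^+\cup\mathbb{R}$. The class $\mathbf{N}_1$ consists of functions $Q$ meromorphic on $\mathbb{C}^+$ for which the kernel $\mathsf{N}_Q(z,w)=\frac{Q(z)-\overline{Q(w)}}{z-\bar w}$, $z,w\in\mathbb{C}^+$ (points of holomorphy), has precisely one negative square: every Hermitian matrix $(\mathsf{N}_Q(z_i,z_j))_{i,j}$ has at most one negative eigenvalue (with multiplicity), and at least one such matrix has exactly one. It is known that each $Q\in\mathbf{N}_1$ has a unique factorization $Q=RM$ with $M$ a Nevanlinna function and $R(z)$ of one of the forms $\frac{(z-\alpha)(z-\bar\alpha)}{(z-\beta)(z-\bar\beta)}$, $(z-\alpha)(z-\bar\alpha)$, $\frac{1}{(z-\beta)(z-\bar\beta)}$, with $\alpha,\beta\in\mathbb{C}^+\cup\mathbb{R}$; $\alpha$ is called the generalized zero of nonpositive type (GZNT) and $\beta$ the generalized pole of nonpositive type (GPNT) of $Q$, where $\beta=\infty$ in the second form and $\alpha=\infty$ in the third form. For $\tau\in\mathbb{R}$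 put $Q_\tau(z)=\frac{Q(z)-\tau}{1+\tau Q(z)}$ and put $Q_\infty(z)=-1/Q(z)$. It is known that $Q_\tau\in\mathbf{N}_1$ for all $\tau\in\mathbb{R}\cup\{\infty\}$; $\alpha(\tau)\in\mathbb{C}^+\cup\mathbb{R}\cup\{\infty\}$ denotes the GZNT of $Q_\tau$. It is also known that $\tau\mapsto\alpha(\tau)$ is injective. That $Q$ extends to a holomorphic function $\widetilde Q$ in $\Omega$ means that $\widetilde Q$ is holomorphic on $\Omega$ and coincides with $Q$ on $\Omega\cap\mathbb{C}^+$; the symmetry $\overline{\widetilde Q(z)}=\widetilde Q(\bar z)$ is not assumed. An inequality such as $\widetilde Q'(z_0)<0$ means that the number is real and satisfies the inequality. The function $\alpha(\tau)$ being holomorphic on a real interval means that it is the restriction to that interval of a function holomorphic in a complex neighborhood of the interval (i.e. it is finite and real-analytic there with complex values). Arguments of nonzero numbers in the closed upper half-plane are taken in $[0,\pi]$; $\arg$ otherwise denotes the principal argument in $(-\pi,\pi]$. *)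

theory Defs
  imports "HOL-Complex_Analysis.Complex_Analysis" "Jordan_Normal_Form.Char_Poly"
begin

abbreviation upper_half_plane :: "complex set" ("\<complex>\<^sup>+")
  where "\<complex>\<^sup>+ \<equiv> {z. Im z > 0}"

definition nevanlinna :: "(complex \<Rightarrow> complex) \<Rightarrow> bool" where
  "nevanlinna M \<longleftrightarrow>
     M holomorphic_on - \<real> \<and>
     (\<forall>z \<in> - \<real>. cnj (M z) = M (cnj z)) \<and>
     M ` \<complex>\<^sup>+ \<subseteq> \<complex>\<^sup>+ \<union> \<real>"

definition nevanlinna_kernel :: "(complex \<Rightarrow> complex) \<Rightarrow> complex \<Rightarrow> complex \<Rightarrow> complex" where
  "nevanlinna_kernel Q z w = (Q z - cnj (Q w)) / (z - cnj w)"

definition kernel_matrix :: "(complex \<Rightarrow> complex) \<Rightarrow> complex list \<Rightarrow> complex Matrix.mat" where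
  "kernel_matrix Q zs =
     Matrix.mat (length zs) (length zs) (\<lambda>(i, j). nevanlinna_kernel Q (zs ! i) (zs ! j))"

text \<open>
  Multiplicity is the order as a root of the characteristic polynomial. It is applied to Hermitian
  matrices only, for which it is the dimension of the eigenspace.
\<close>

definition num_neg_eigenvalues :: "complex Matrix.mat \<Rightarrow> nat" where
  "num_neg_eigenvalues A =
     (\<Sum>x | eigenvalue A x \<and> x \<in> \<real> \<and> Re x < 0. Polynomial.order x (char_poly A))"

definition points_of_holomorphy :: "(complex \<Rightarrow> complex) \<Rightarrow> complex set" where
  "points_of_holomorphy Q = {z \<in> \<complex>\<^sup>+. Q analytic_on {z}}"

definition N1 :: "(complex \<Rightarrow> complex) set" where
  "N1 = {Q. Q meromorphic_on \<complex>\<^sup>+ \<and>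
     (\<forall>zs \<in> lists (points_of_holomorphy Q). num_neg_eigenvalues (kernel_matrix Q zs) \<le> 1) \<and>
     (\<exists>zs \<in> lists (points_of_holomorphy Q). num_neg_eigenvalues (kernel_matrix Q zs) = 1)}"

text \<open>
  Generalized zeros and poles lie in the closed upper half-plane or at infinity. They are
  modelled by the type \<^typ>\<open>complex option\<close>, where \<^const>\<open>None\<close> stands for
  infinity. The factor belonging to the point at infinity is absent, so the three admissible
  forms of the rational factor correspond to the pairs that are not both infinite.
\<close>

definition ext_closed_upper_half_plane :: "complex option set" where
  "ext_closed_upper_half_plane = insert None (Some ` (\<complex>\<^sup>+ \<union> \<real>))"

definition quad_factor :: "complex option \<Rightarrow> complex \<Rightarrow> complex" where
  "quad_factor a z = (case a of None \<Rightarrow> 1 | Some c \<Rightarrow> (z - c) * (z - cnj c))"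

text \<open>
  Equality of meromorphic functions is equality off a set without accumulation points in
  the upper half-plane, because the values of a HOL function at poles and at removable
  singularities carry no information.
\<close>

definition is_factorization ::
  "(complex \<Rightarrow> complex) \<Rightarrow> complex option \<Rightarrow> complex option \<Rightarrow> (complex \<Rightarrow> complex) \<Rightarrow> bool" where
  "is_factorization Q a b M \<longleftrightarrow>
     a \<in> ext_closed_upper_half_plane \<and> b \<in> ext_closed_upper_half_plane \<and>
     \<not> (a = None \<and> b = None) \<and>
     nevanlinna M \<and>
     (\<forall>\<^sub>\<approx>z\<in>\<complex>\<^sup>+. Q z = quad_factor a z / quad_factor b z * M z)"

text \<open>
  GZNT: generalized zero of nonpositive type. It is unique, and exists, for functions in
  \<^const>\<open>N1\<close>; hence a predicate rather than a definite description.
\<close>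

definition is_gznt :: "(complex \<Rightarrow> complex) \<Rightarrow> complex option \<Rightarrow> bool" where
  "is_gznt Q a \<longleftrightarrow> (\<exists>b M. is_factorization Q a b M)"

definition Q_transform :: "(complex \<Rightarrow> complex) \<Rightarrow> real \<Rightarrow> complex \<Rightarrow> complex" where
  "Q_transform Q \<tau> z = (Q z - of_real \<tau>) / (1 + of_real \<tau> * Q z)"

definition holomorphic_on_interval :: "(real \<Rightarrow> complex option) \<Rightarrow> real set \<Rightarrow> bool" where
  "holomorphic_on_interval \<alpha> I \<longleftrightarrow>
     (\<exists>f U. open U \<and> of_real ` I \<subseteq> U \<and> f holomorphic_on U \<and>
            (\<forall>t\<in>I. \<alpha> t = Some (f (of_real t))))"

text \<open>
  \<^const>\<open>Arg\<close> is the principal argument; on nonzero points of the closed upper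
  half-plane its values lie in the interval from 0 to pi. The junk value of \<^const>\<open>the\<close> at
  infinity is irrelevant when \<open>\<alpha>\<close> is finite near the point at which a limit is taken.
\<close>

definition arg_from :: "(real \<Rightarrow> complex option) \<Rightarrow> real \<Rightarrow> real \<Rightarrow> real" where
  "arg_from \<alpha> z0 \<tau> = Arg (the (\<alpha> \<tau>) - of_real z0)"

definition exactly_one :: "bool \<Rightarrow> bool \<Rightarrow> bool \<Rightarrow> bool" where
  "exactly_one A B C \<longleftrightarrow> (A \<or> B \<or> C) \<and> \<not> (A \<and> B) \<and> \<not> (A \<and> C) \<and> \<not> (B \<and> C)"

end

theory Submission imports Defs begin

text \<open>
  Near \<open>z0\<close> the generalized zero \<open>\<alpha> \<tau>\<close> is a solution \<open>z\<close> of \<open>Qt z = \<tau>\<close>. Indeed, a solution in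
  the open upper half-plane is a zero of \<open>Q_\<tau> = R M\<close> at which the Nevanlinna factor \<open>M\<close> cannot
  vanish, so it is a zero of \<open>R\<close>, hence it is \<open>\<alpha> \<tau>\<close>. The same holds for a real solution \<open>x\<close> with
  \<open>Qt' x < 0\<close>: otherwise \<open>M\<close> would behave at \<open>x\<close> like a negative multiple of \<open>z - x\<close> or like a
  multiple of its cube, and would not map the upper half-plane into its closure. So \<open>\<alpha>\<close> is found
  near \<open>\<tau>0\<close> by exhibiting a solution of one of these two kinds
  (\<open>gznt_eq_interior_solution\<close>, \<open>gznt_eq_boundary_solution\<close>).
  
  The local shape of the solution set is governed by the order \<open>n\<close> of \<open>Qt - \<tau>0\<close> at \<open>z0\<close>. By
  the factorization of \<open>Q_\<tau>0\<close>, whose rational factor has a double zero at \<open>z0\<close>, the function \<open>M\<close>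
  behaves like \<open>C * (z - z0) ^ (n - 2)\<close> with \<open>C\<close> a positive multiple of the leading coefficient of
  \<open>Qt - \<tau>0\<close>. A power of order \<open>k\<close> opens the angle \<open>\<pi>\<close> of the half-plane to \<open>\<bar>k\<bar> \<pi>\<close>, so \<open>\<bar>k\<bar> \<le> 1\<close>; this
  leaves \<open>n = 1, 2, 3\<close> and fixes the argument of the coefficient as far as the three cases require
  (\<open>int_multiple_of_sector_in_half_plane\<close>, \<open>boundary_order\<close>, \<open>order_at_gznt\<close>). The one
  degenerate possibility, a generalized pole cancelling the double zero, would turn \<open>Q\<close> itself
  into a Nevanlinna function; its kernel would be nonnegative by Pick's theorem, against the
  negative square that membership in \<^const>\<open>N1\<close> demands (\<open>N1_not_nevanlinna\<close>, \<open>gznt_ne_gpnt\<close>).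
  
  Finally \<open>Qt - \<tau>0 = \<phi> ^ n\<close> with \<open>\<phi>\<close> locally biholomorphic at \<open>z0\<close>. The solutions of \<open>Qt z = \<tau>\<close> are the
  values of \<open>\<psi> = \<phi>\<inverse>\<close> at the \<open>n\<close>-th roots of \<open>\<tau> - \<tau>0\<close>: \<open>n\<close> analytic arcs for each sign of \<open>\<tau> - \<tau>0\<close>,
  leaving \<open>z0\<close> in directions that are determined by the leading coefficient. An arc with direction
  strictly inside the upper half-plane is \<open>\<alpha>\<close>. An arc tangent to the real axis stays in the
  closed upper half-plane because \<open>Im Qt \<ge> 0\<close> on the real axis while \<open>Im Qt\<close> strictly decreases
  upwards along vertical segments near such an arc (\<open>branch_eventually_upper_and_negative\<close>).
  The limits of the arguments are the directions of these arcs.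
\<close>

section \<open>Positivity of the Nevanlinna kernel\<close>

text \<open>
  With \<open>A \<zeta> = (\<Sum>i\<in>I. v i / (\<zeta> - z i))\<close>, Cauchy's integral formula identifies the double sum with the
  mean of \<open>G * \<bar>A\<bar>\<^sup>2\<close> over the circle, whose real part is visibly nonnegative. The double sum is only
  half of the Hermitian form; the other half is its conjugate.
\<close>

lemma disk_kernel_nonneg:
  fixes G :: "complex \<Rightarrow> complex" and z v :: "'i \<Rightarrow> complex" and c :: complex and \<rho> :: real
  assumes cont: "continuous_on (cball c \<rho>) G" and hol: "G holomorphic_on ball c \<rho>" and \<rho>: "\<rho> > 0"
    and G: "\<And>\<zeta>. \<zeta> \<in> cball c \<rho> \<Longrightarrow> Re (G \<zeta>) \<ge> 0"
    and fin: "finite I" and z: "\<And>i. i \<in> I \<Longrightarrow> z i \<in> ball c \<rho>"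
  shows "Re (\<Sum>i\<in>I. \<Sum>j\<in>I. v i * cnj (v j) * G (z i) / (of_real (\<rho>\<^sup>2) - (z i - c) * cnj (z j - c))) \<ge> 0"
proof -
  define A where "A \<zeta> = (\<Sum>i\<in>I. v i / (\<zeta> - z i))" for \<zeta>
  define B where "B \<zeta> = (\<Sum>j\<in>I. cnj (v j) / (of_real (\<rho>\<^sup>2) - (\<zeta> - c) * cnj (z j - c)))" for \<zeta>
  define T where "T = (\<Sum>i\<in>I. v i * (G (z i) * B (z i)))"
  have den: "of_real (\<rho>\<^sup>2) - (\<zeta> - c) * cnj (z j - c) \<noteq> 0" if "\<zeta> \<in> cball c \<rho>" "j \<in> I" for \<zeta> j
  proof -
    have "cmod ((\<zeta> - c) * cnj (z j - c)) = cmod (\<zeta> - c) * cmod (z j - c)"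
      by (metis complex_mod_cnj norm_mult)
    also have "\<dots> \<le> \<rho> * cmod (z j - c)"
      using that(1) by (intro mult_right_mono) (auto simp: dist_norm norm_minus_commute)
    also have "\<dots> < \<rho> * \<rho>"
      using z[OF that(2)] \<rho> by (intro mult_strict_left_mono) (auto simp: dist_norm norm_minus_commute)
    finally have "cmod ((\<zeta> - c) * cnj (z j - c)) < cmod (of_real (\<rho>\<^sup>2))"
      by (simp add: power2_eq_square norm_mult)
    thus ?thesis by (metis eq_iff_diff_eq_0 less_irrefl)
  qed
  have Bcont: "continuous_on (cball c \<rho>) B"
    unfolding B_def by (intro continuous_intros) (use den in auto)
  have Bhol: "B holomorphic_on ball c \<rho>"
    unfolding B_def by (intro holomorphic_intros) (use den in auto)
  have "((\<lambda>u. v i * (G u * B u / (u - z i))) has_contour_integral v i * (2 * of_real pi * \<i> * (G (z i) * B (z i))))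
          (circlepath c \<rho>)" if "i \<in> I" for i
    by (intro has_contour_integral_lmul Cauchy_integral_circlepath)
       (use z[OF that] in \<open>auto intro!: continuous_intros holomorphic_intros cont Bcont hol Bhol simp: dist_norm norm_minus_commute\<close>)
  hence "((\<lambda>u. \<Sum>i\<in>I. v i * (G u * B u / (u - z i))) has_contour_integral
          (\<Sum>i\<in>I. v i * (2 * of_real pi * \<i> * (G (z i) * B (z i))))) (circlepath c \<rho>)"
    by (intro has_contour_integral_sum fin)
  moreover have "(\<Sum>i\<in>I. v i * (2 * of_real pi * \<i> * (G (z i) * B (z i)))) = 2 * of_real pi * \<i> * T"
    by (simp add: T_def sum_distrib_left mult_ac)
  moreover have "(\<Sum>i\<in>I. v i * (G u * B u / (u - z i))) = G u * (B u * A u)" for u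
    by (simp add: A_def sum_distrib_left mult_ac)
  ultimately have "((\<lambda>u. G u * (B u * A u)) has_contour_integral 2 * of_real pi * \<i> * T) (circlepath c \<rho>)"
    by simp
  hence I: "((\<lambda>x. G (circlepath c \<rho> x) * (B (circlepath c \<rho> x) * A (circlepath c \<rho> x)) *
          vector_derivative (circlepath c \<rho>) (at x within {0..1})) has_integral 2 * of_real pi * \<i> * T) {0..1}"
    by (simp add: has_contour_integral_def)
  \<comment> \<open>Since \<open>(\<zeta> - c) * cnj (\<zeta> - c) = \<rho>\<^sup>2\<close> on the circle, the factor \<open>\<zeta> - c\<close> coming from
     \<open>d\<zeta>\<close> turns \<open>B\<close> into the conjugate of \<open>A\<close>.\<close>
  have eq: "B \<zeta> * (\<zeta> - c) = cnj (A \<zeta>)" if "\<zeta> \<in> sphere c \<rho>" for \<zeta>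
  proof -
    have nz: "\<zeta> - c \<noteq> 0" using that \<rho> by auto
    have r2: "of_real (\<rho>\<^sup>2) = (\<zeta> - c) * cnj (\<zeta> - c)"
      using that by (subst complex_norm_square[symmetric]) (simp add: dist_norm norm_minus_commute)
    have "cnj (v j) / (of_real (\<rho>\<^sup>2) - (\<zeta> - c) * cnj (z j - c)) * (\<zeta> - c) = cnj (v j / (\<zeta> - z j))"
      if "j \<in> I" for j
    proof -
      have "of_real (\<rho>\<^sup>2) - (\<zeta> - c) * cnj (z j - c) = (\<zeta> - c) * cnj (\<zeta> - z j)"
        unfolding r2 by (simp add: algebra_simps)
      thus ?thesis using nz by simp
    qed
    thus ?thesis by (simp add: A_def B_def sum_distrib_right)
  qed
  have on: "circlepath c \<rho> x \<in> sphere c \<rho>" for x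
    using \<rho> by (simp add: circlepath dist_norm norm_mult)
  have vd: "vector_derivative (circlepath c \<rho>) (at x within {0..1}) = 2 * of_real pi * \<i> * (circlepath c \<rho> x - c)"
    if "x \<in> {0..1}" for x
    using that by (subst vector_derivative_circlepath01) (auto simp: circlepath)
  have "((\<lambda>x. 2 * of_real pi * \<i> * (G (circlepath c \<rho> x) * of_real ((cmod (A (circlepath c \<rho> x)))\<^sup>2))) has_integral 2 * of_real pi * \<i> * T) {0..1}"
  proof (rule has_integral_eq[OF _ I])
    fix x :: real assume x: "x \<in> {0..1}"
    define \<zeta> where "\<zeta> = circlepath c \<rho> x"
    have "G \<zeta> * (B \<zeta> * A \<zeta>) * (2 * of_real pi * \<i> * (\<zeta> - c)) = 2 * of_real pi * \<i> * (G \<zeta> * ((B \<zeta> * (\<zeta> - c)) * A \<zeta>))"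
      by (simp only: mult_ac)
    also have "(B \<zeta> * (\<zeta> - c)) * A \<zeta> = of_real ((cmod (A \<zeta>))\<^sup>2)"
      using eq[OF on[of x]] by (subst complex_norm_square) (simp add: \<zeta>_def mult.commute)
    finally show "G (circlepath c \<rho> x) * (B (circlepath c \<rho> x) * A (circlepath c \<rho> x)) *
          vector_derivative (circlepath c \<rho>) (at x within {0..1}) = 2 * of_real pi * \<i> * (G (circlepath c \<rho> x) * of_real ((cmod (A (circlepath c \<rho> x)))\<^sup>2))"
      unfolding vd[OF x] by (simp add: \<zeta>_def)
  qed
  from has_integral_mult_right[OF this, of "1 / (2 * of_real pi * \<i>)"]
  have "((\<lambda>x. G (circlepath c \<rho> x) * of_real ((cmod (A (circlepath c \<rho> x)))\<^sup>2)) has_integral T) {0..1}"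
    by simp
  hence "((\<lambda>x. Re (G (circlepath c \<rho> x) * of_real ((cmod (A (circlepath c \<rho> x)))\<^sup>2))) has_integral Re T) {0..1}"
    by (drule_tac has_integral_linear[OF _ bounded_linear_Re]) (simp add: o_def)
  hence "Re T \<ge> 0"
    by (rule has_integral_nonneg) (use on G in \<open>auto intro!: mult_nonneg_nonneg simp: \<rho> less_imp_le\<close>)
  thus ?thesis by (simp add: T_def B_def sum_distrib_left mult_ac)
qed

text \<open>
  The half-plane is exhausted by the disks with centre \<open>\<i> R\<close> and radius \<open>R - 1 / R\<close>. After scaling by
  \<open>R\<close> the disk kernel tends to the kernel of the half-plane, because the error in the denominator is
  \<open>R\<^sup>2 - (R - 1 / R)\<^sup>2\<close>, which is bounded.
\<close>

lemma pick_form_nonneg: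
  fixes F :: "complex \<Rightarrow> complex" and z v :: "'i \<Rightarrow> complex"
  assumes hol: "F holomorphic_on \<complex>\<^sup>+" and F: "\<And>\<zeta>. Im \<zeta> > 0 \<Longrightarrow> Im (F \<zeta>) \<ge> 0"
    and fin: "finite I" and z: "\<And>i. i \<in> I \<Longrightarrow> Im (z i) > 0"
  shows "Re (\<Sum>i\<in>I. \<Sum>j\<in>I. v i * cnj (v j) * nevanlinna_kernel F (z i) (z j)) \<ge> 0"
proof -
  define G where "G \<zeta> = - \<i> * F \<zeta>" for \<zeta>
  define S where "S R = (\<Sum>i\<in>I. \<Sum>j\<in>I. v i * cnj (v j) * G (z i) /
     ((of_real ((R - 1/R)\<^sup>2) - (z i - \<i> * of_real R) * cnj (z j - \<i> * of_real R)) / of_real R))" for R :: real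
  \<comment> \<open>The half of the Hermitian form that involves \<open>F (z i)\<close>; the full form is \<open>T + cnj T\<close>.\<close>
  define T where "T = (\<Sum>i\<in>I. \<Sum>j\<in>I. v i * cnj (v j) * F (z i) / (z i - cnj (z j)))"
  have lim: "((\<lambda>R. (of_real ((R - 1/R)\<^sup>2) - (x - \<i> * of_real R) * cnj (y - \<i> * of_real R)) / of_real R)
     \<longlongrightarrow> - \<i> * (x - cnj y)) at_top" for x y :: complex
  proof -
    have "((\<lambda>R. (of_real (1/R^2) - 2 - x * cnj y) * of_real (1/R) - \<i> * (x - cnj y)) \<longlongrightarrow> (of_real 0 - 2 - x * cnj y) * of_real 0 - \<i> * (x - cnj y)) at_top"
      by (intro tendsto_intros) real_asymp+
    moreover have "eventually (\<lambda>R. (of_real (1/R^2) - 2 - x * cnj y) * of_real (1/R) - \<i> * (x - cnj y) = (of_real ((R - 1/R)\<^sup>2) - (x - \<i> * of_real R) * cnj (y - \<i> * of_real R)) / of_real R) (at_top :: real filter)"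
      using eventually_gt_at_top[of 0]
      by eventually_elim (simp add: field_simps power2_eq_square)
    ultimately show ?thesis
      by (simp add: filterlim_cong[OF refl refl] tendsto_cong)
  qed
  have "(S \<longlongrightarrow> (\<Sum>i\<in>I. \<Sum>j\<in>I. v i * cnj (v j) * G (z i) / (- \<i> * (z i - cnj (z j))))) at_top"
    unfolding S_def
  proof (intro tendsto_sum tendsto_divide tendsto_const lim)
    fix i j assume "i \<in> I" "j \<in> I"
    hence "Im (z i - cnj (z j)) > 0" using z by (simp add: add_pos_pos)
    thus "- \<i> * (z i - cnj (z j)) \<noteq> 0" by force
  qed
  also have "(\<Sum>i\<in>I. \<Sum>j\<in>I. v i * cnj (v j) * G (z i) / (- \<i> * (z i - cnj (z j)))) = T"
    unfolding T_def by (intro sum.cong refl) (simp add: G_def)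
  finally have "((\<lambda>R. Re (S R)) \<longlongrightarrow> Re T) at_top" by (rule tendsto_Re)
  moreover have "eventually (\<lambda>R. Re (S R) \<ge> 0) at_top"
  proof -
    have "eventually (\<lambda>R. \<forall>i\<in>I. z i \<in> ball (\<i> * of_real R) (R - 1/R)) at_top"
    proof (intro eventually_ball_finite fin ballI)
      fix i assume i: "i \<in> I"
      define a b where "a = (cmod (z i))\<^sup>2 + 2" and "b = Im (z i)"
      have "b > 0" using z[OF i] by (simp add: b_def)
      hence "eventually (\<lambda>R. a - 2 * R * b < 0 \<and> R > (1::real)) at_top"
        by (intro eventually_conj eventually_gt_at_top) real_asymp
      thus "eventually (\<lambda>R. z i \<in> ball (\<i> * of_real R) (R - 1/R)) at_top"
      proof eventually_elim
        case (elim R)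
        have "(cmod (z i - \<i> * of_real R))\<^sup>2 = (cmod (z i))\<^sup>2 - 2 * R * Im (z i) + R\<^sup>2"
          by (simp only: cmod_power2) (simp add: power2_eq_square algebra_simps)
        also have "\<dots> < R\<^sup>2 - 2" using elim by (simp add: a_def b_def)
        also have "\<dots> \<le> (R - 1/R)\<^sup>2"
          using elim by (simp add: power2_diff power_one_over)
        finally have "(cmod (z i - \<i> * of_real R))\<^sup>2 < (R - 1/R)\<^sup>2" .
        moreover have "1/R < 1" using elim by simp
        hence "0 \<le> R - 1/R" using elim by linarith
        ultimately have "cmod (z i - \<i> * of_real R) < R - 1/R"
          by (rule power_less_imp_less_base)
        thus ?case by (simp add: dist_norm norm_minus_commute)
      qed
    qed
    moreover have "eventually (\<lambda>R::real. R > 1) at_top" by (rule eventually_gt_at_top)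
    ultimately show ?thesis
    proof eventually_elim
      case (elim R)
      have "1/R < 1" using elim by simp
      hence \<rho>: "R - 1/R > 0" using elim by linarith
      have up: "Im \<zeta> > 0" if "\<zeta> \<in> cball (\<i> * of_real R) (R - 1/R)" for \<zeta>
      proof -
        have "R - Im \<zeta> \<le> cmod (\<i> * of_real R - \<zeta>)" using complex_Re_le_cmod[of "-\<i> * (\<i> * of_real R - \<zeta>)"]
          by (simp add: norm_mult)
        hence "R - Im \<zeta> \<le> R - 1/R" using that by (simp add: dist_norm)
        moreover have "1/R > 0" using elim by simp
        ultimately show ?thesis by linarith
      qed
      have "Re (\<Sum>i\<in>I. \<Sum>j\<in>I. v i * cnj (v j) * G (z i) / (of_real ((R - 1/R)\<^sup>2) - (z i - \<i> * of_real R) * cnj (z j - \<i> * of_real R))) \<ge> 0" (is "Re ?K \<ge> 0")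
      proof (rule disk_kernel_nonneg[OF _ _ \<rho> _ fin])
        have "G holomorphic_on \<complex>\<^sup>+" unfolding G_def by (intro holomorphic_intros hol)
        thus "G holomorphic_on ball (\<i> * of_real R) (R - 1/R)" "continuous_on (cball (\<i> * of_real R) (R - 1/R)) G"
          using up by (auto intro!: holomorphic_on_imp_continuous_on elim!: holomorphic_on_subset)
        show "Re (G \<zeta>) \<ge> 0" if "\<zeta> \<in> cball (\<i> * of_real R) (R - 1/R)" for \<zeta>
          using F[OF up[OF that]] by (simp add: G_def)
      qed (use elim in auto)
      moreover have "S R = of_real R * ?K"
        using elim by (simp add: S_def sum_distrib_left mult_ac)
      ultimately show ?case using elim by simp
    qed
  qed
  ultimately have T: "Re T \<ge> 0"
    by (intro tendsto_lowerbound[of _ "Re T" at_top 0]) auto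
  have "cnj T = (\<Sum>i\<in>I. \<Sum>j\<in>I. cnj (v i) * v j * cnj (F (z i)) / (cnj (z i) - z j))"
    by (simp add: T_def)
  also have "\<dots> = (\<Sum>i\<in>I. \<Sum>j\<in>I. v i * cnj (v j) * (- cnj (F (z j))) / (z i - cnj (z j)))"
    by (subst sum.swap, intro sum.cong refl) (metis minus_diff_eq minus_divide_divide mult.commute mult_minus_right)
  finally have "T + cnj T = (\<Sum>i\<in>I. \<Sum>j\<in>I. v i * cnj (v j) * nevanlinna_kernel F (z i) (z j))"
    unfolding T_def nevanlinna_kernel_def by (simp add: sum.distrib[symmetric] algebra_simps diff_divide_distrib)
  moreover have "Re (T + cnj T) = 2 * Re T" by simp
  ultimately show ?thesis using T by simp
qed

lemma Re_eigenvalue_nonneg: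
  fixes K :: "nat \<Rightarrow> nat \<Rightarrow> complex" and u :: "nat \<Rightarrow> complex"
  assumes form: "\<And>v :: nat \<Rightarrow> complex. Re (\<Sum>i<n. \<Sum>j<n. v i * cnj (v j) * K i j) \<ge> 0"
    and row: "\<And>i. i < n \<Longrightarrow> (\<Sum>j<n. K i j * u j) = x * u i"
    and k: "k < n" "u k \<noteq> 0"
  shows "Re x \<ge> 0"
proof -
  have "(\<Sum>j<n. cnj (u i) * cnj (cnj (u j)) * K i j) = x * of_real ((cmod (u i))\<^sup>2)" if "i < n" for i
  proof -
    have "(\<Sum>j<n. cnj (u i) * cnj (cnj (u j)) * K i j) = cnj (u i) * (\<Sum>j<n. K i j * u j)"
      by (simp only: sum_distrib_left mult_ac complex_cnj_cnj)
    also have "\<dots> = x * (u i * cnj (u i))"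
      unfolding row[OF that] by (simp only: mult_ac)
    finally show ?thesis by (simp only: complex_norm_square)
  qed
  hence "(\<Sum>i<n. \<Sum>j<n. cnj (u i) * cnj (cnj (u j)) * K i j) = (\<Sum>i<n. x * of_real ((cmod (u i))\<^sup>2))"
    by (intro sum.cong) simp_all
  also have "\<dots> = x * of_real (\<Sum>i<n. (cmod (u i))\<^sup>2)"
    by (simp only: of_real_sum sum_distrib_left)
  finally have eq: "(\<Sum>i<n. \<Sum>j<n. cnj (u i) * cnj (cnj (u j)) * K i j) = x * of_real (\<Sum>i<n. (cmod (u i))\<^sup>2)" .
  have "Re x * (\<Sum>i<n. (cmod (u i))\<^sup>2) \<ge> 0"
    using form[of "\<lambda>i. cnj (u i)"] unfolding eq by simp
  moreover have "(\<Sum>i<n. (cmod (u i))\<^sup>2) > 0"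
    by (rule sum_pos2[of _ k]) (use k in auto)
  ultimately show ?thesis by (simp add: zero_le_mult_iff)
qed

lemma eigenvector_rows:
  fixes A :: "complex Matrix.mat"
  assumes "eigenvalue A x" and dim: "dim_row A = n" "dim_col A = n"
  obtains u k where "\<And>i. i < n \<Longrightarrow> (\<Sum>j<n. A $$ (i, j) * u j) = x * u i" "k < n" "u k \<noteq> 0"
proof -
  obtain w where "eigenvector A w x"
    using assms(1) unfolding eigenvalue_def by blast
  hence "w \<in> carrier_vec n \<and> w \<noteq> 0\<^sub>v n \<and> A *\<^sub>v w = x \<cdot>\<^sub>v w"
    unfolding eigenvector_def dim .
  hence w: "dim_vec w = n" "w \<noteq> 0\<^sub>v n" "A *\<^sub>v w = x \<cdot>\<^sub>v w"
    by (blast dest: carrier_vecD)+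
  have row: "(\<Sum>j<n. A $$ (i, j) * vec_index w j) = x * vec_index w i" if i: "i < n" for i
  proof -
    have "vec_index (A *\<^sub>v w) i = (\<Sum>j<n. A $$ (i, j) * vec_index w j)"
      using i w(1) dim by (simp add: scalar_prod_def atLeast0LessThan)
    thus ?thesis unfolding w(3) using w(1) i by simp
  qed
  have "\<exists>k<n. vec_index w k \<noteq> 0"
  proof (rule ccontr)
    assume "\<not> ?thesis"
    hence "w = 0\<^sub>v n" using w(1) by (intro eq_vecI) auto
    with w(2) show False by contradiction
  qed
  then obtain k where "k < n" "vec_index w k \<noteq> 0" by blast
  with row show ?thesis by (rule that[of "vec_index w"])
qed

lemma pick_matrix_no_negative_eigenvalue:
  fixes F :: "complex \<Rightarrow> complex"
  assumes hol: "F holomorphic_on \<complex>\<^sup>+" and F: "\<And>\<zeta>. Im \<zeta> > 0 \<Longrightarrow> Im (F \<zeta>) \<ge> 0"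
    and zs: "\<And>i. i < length zs \<Longrightarrow> Im (zs ! i) > 0"
    and ev: "eigenvalue (kernel_matrix F zs) x"
  shows "Re x \<ge> 0"
proof -
  define K where "K i j = nevanlinna_kernel F (zs ! i) (zs ! j)" for i j
  have dim: "dim_row (kernel_matrix F zs) = length zs" "dim_col (kernel_matrix F zs) = length zs"
    by (simp_all add: kernel_matrix_def)
  obtain u k where uk: "\<And>i. i < length zs \<Longrightarrow> (\<Sum>j<length zs. kernel_matrix F zs $$ (i, j) * u j) = x * u i" "k < length zs" "u k \<noteq> 0"
    using eigenvector_rows[OF ev dim] by metis
  show ?thesis
  proof (rule Re_eigenvalue_nonneg[where K = K and u = u and n = "length zs" and x = x and k = k])
    fix v :: "nat \<Rightarrow> complex"
    have "\<And>i. i \<in> {..<length zs} \<Longrightarrow> Im (zs ! i) > 0" using zs by simp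
    from pick_form_nonneg[where z = "(!) zs" and v = v and I = "{..<length zs}" and F = F, OF hol F finite_lessThan this]
    show "Re (\<Sum>i<length zs. \<Sum>j<length zs. v i * cnj (v j) * K i j) \<ge> 0" unfolding K_def .
  next
    fix i assume i: "i < length zs"
    have "kernel_matrix F zs $$ (i, j) = K i j" if "j \<in> {..<length zs}" for j
      using i that by (simp add: kernel_matrix_def K_def)
    thus "(\<Sum>j<length zs. K i j * u j) = x * u i"
      using uk(1)[OF i] by simp
  qed (fact uk(2), fact uk(3))
qed

lemma eq_if_eventually_cosparse:
  fixes f g :: "complex \<Rightarrow> 'a :: t2_space"
  assumes ev: "\<forall>\<^sub>\<approx>z\<in>S. f z = g z" and z: "z \<in> S"
    and cont: "isCont f z" "isCont g z"
  shows "f z = g z"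
proof (rule tendsto_unique)
  show "at z \<noteq> bot" by simp
  show "f \<midarrow>z\<rightarrow> f z" using cont(1) by (simp add: isCont_def)
  have "eventually (\<lambda>z. f z = g z) (at z)"
    using eventually_cosparse_imp_eventually_at[OF ev z] .
  thus "f \<midarrow>z\<rightarrow> g z" using cont(2) by (simp add: isCont_def tendsto_cong)
qed

text \<open>
  The quantifier over all points but a sparse set is removed by continuity: at its points of
  holomorphy \<open>Q\<close> coincides with \<open>F\<close>, so the kernel matrices of \<open>Q\<close> are those of \<open>F\<close> and have no
  negative eigenvalue.
\<close>

lemma N1_not_nevanlinna:
  assumes Q: "Q \<in> N1" and hol: "F holomorphic_on \<complex>\<^sup>+"
    and F: "\<And>\<zeta>. Im \<zeta> > 0 \<Longrightarrow> Im (F \<zeta>) \<ge> 0"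
    and eq: "\<forall>\<^sub>\<approx>z\<in>\<complex>\<^sup>+. Q z = F z"
  shows False
proof -
  have op: "open \<complex>\<^sup>+" by (simp add: open_halfspace_Im_gt)
  have QF: "Q z = F z" if "z \<in> points_of_holomorphy Q" for z
  proof (rule eq_if_eventually_cosparse[OF eq])
    show z: "z \<in> \<complex>\<^sup>+" and "isCont Q z"
      using that by (auto simp: points_of_holomorphy_def analytic_at_imp_isCont)
    show "isCont F z"
      using holomorphic_on_imp_continuous_on[OF hol] z by (simp add: continuous_on_eq_continuous_at[OF op])
  qed
  obtain zs where zs: "zs \<in> lists (points_of_holomorphy Q)" "num_neg_eigenvalues (kernel_matrix Q zs) = 1"
    using Q unfolding N1_def by blast
  have mem: "zs ! i \<in> points_of_holomorphy Q" if "i < length zs" for i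
    using zs(1) that by (meson in_lists_conv_set nth_mem)
  have eqm: "kernel_matrix Q zs = kernel_matrix F zs"
    unfolding kernel_matrix_def by (rule cong_mat) (simp_all add: nevanlinna_kernel_def QF[OF mem])
  have none: "{x. eigenvalue (kernel_matrix F zs) x \<and> x \<in> \<real> \<and> Re x < 0} = {}"
  proof -
    have "Im (zs ! i) > 0" if "i < length zs" for i
      using mem[OF that] unfolding points_of_holomorphy_def by blast
    note nonneg = pick_matrix_no_negative_eigenvalue[OF hol F this]
    show ?thesis
    proof (rule equals0I)
      fix x assume "x \<in> {x. eigenvalue (kernel_matrix F zs) x \<and> x \<in> \<real> \<and> Re x < 0}"
      hence "eigenvalue (kernel_matrix F zs) x" "Re x < 0" by simp_all
      with nonneg[of x] show False by linarith
    qed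
  qed
  have "num_neg_eigenvalues (kernel_matrix Q zs) = 0"
    by (simp only: eqm num_neg_eigenvalues_def none sum.empty)
  with zs(2) show False by simp
qed

section \<open>Orders of growth of Nevanlinna functions at the real axis\<close>

text \<open>
  If \<open>\<bar>k\<bar> \<ge> 2\<close>, then shifting \<open>\<theta>\<close> by \<open>\<pi> / \<bar>k\<bar> \<le> \<pi> / 2\<close> changes the sign of the value, so the imaginary
  part vanishes for all \<open>\<theta>\<close> between \<open>0\<close> and \<open>\<pi> / 2\<close>; two angles for which \<open>k \<theta>\<close> differs by a right
  angle then force \<open>c = 0\<close>. For \<open>k = \<plusminus>1\<close> the limits at \<open>0\<close> and \<open>\<pi>\<close> force \<open>c\<close> to be real, and
  \<open>\<theta> = \<pi> / 2\<close> gives its sign.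
\<close>

lemma int_multiple_of_sector_in_half_plane:
  fixes c :: complex and k :: int
  assumes c: "c \<noteq> 0" and sector: "\<And>\<theta>. 0 < \<theta> \<Longrightarrow> \<theta> < pi \<Longrightarrow> Im (c * cis (of_int k * \<theta>)) \<ge> 0"
  shows "k = -1 \<and> c \<in> \<real> \<and> Re c < 0 \<or> k = 0 \<and> Im c \<ge> 0 \<or> k = 1 \<and> c \<in> \<real> \<and> Re c > 0"
proof -
  have "closed {\<theta>. Im (c * cis (of_int k * \<theta>)) \<ge> 0}"
    by (intro closed_Collect_le continuous_intros)
  hence "closure {0<..<pi} \<subseteq> {\<theta>. Im (c * cis (of_int k * \<theta>)) \<ge> 0}"
    using sector by (intro closure_minimal) auto
  hence closed: "Im (c * cis (of_int k * \<theta>)) \<ge> 0" if "0 \<le> \<theta>" "\<theta> \<le> pi" for \<theta>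
    using that by (auto simp: closure_greaterThanLessThan)
  have small: "\<bar>k\<bar> \<le> 1"
  proof (rule ccontr)
    assume "\<not> \<bar>k\<bar> \<le> 1"
    hence k: "\<bar>k\<bar> \<ge> 2" by simp
    define m where "m = real_of_int \<bar>k\<bar>"
    have m: "m \<ge> 2" using k by (simp add: m_def)
    define s where "s = real_of_int (sgn k)"
    have s: "s = 1 \<or> s = -1" using k by (auto simp: s_def sgn_if)
    have ks: "of_int k = s * m" unfolding s_def m_def of_int_mult[symmetric] mult_sgn_abs ..
    have shift: "c * cis (of_int k * (\<theta> + pi / m)) = - (c * cis (of_int k * \<theta>))" for \<theta>
    proof -
      have "of_int k * (\<theta> + pi / m) = of_int k * \<theta> + s * pi" using m by (simp add: ks field_simps)
      moreover have "cis (s * pi) = -1" using s by (auto simp: complex_eq_iff)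
      ultimately show ?thesis by (simp flip: cis_mult)
    qed
    have zero: "Im (c * cis (of_int k * \<theta>)) = 0" if "0 \<le> \<theta>" "\<theta> \<le> pi / 2" for \<theta>
    proof -
      have "pi / m \<le> pi / 2" using m by (intro divide_left_mono) auto
      moreover have "pi / m \<ge> 0" using m by simp
      ultimately have "Im (c * cis (of_int k * (\<theta> + pi / m))) \<ge> 0"
        using that by (intro closed) linarith+
      hence "Im (c * cis (of_int k * \<theta>)) \<le> 0" unfolding shift by simp
      moreover have "Im (c * cis (of_int k * \<theta>)) \<ge> 0" using that by (intro closed) auto
      ultimately show ?thesis by simp
    qed
    have Imc: "Im c = 0" using zero[of 0] by simp
    have "Im (c * cis (of_int k * (pi / (2 * m)))) = 0"
    proof (intro zero)
      have "pi / (2 * m) \<le> pi / 2" using m by (intro divide_left_mono) auto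
      thus "pi / (2 * m) \<le> pi / 2" "0 \<le> pi / (2 * m)" using m by auto
    qed
    moreover have "of_int k * (pi / (2 * m)) = s * (pi / 2)" using m by (simp add: ks)
    ultimately have "Im (c * cis (s * (pi / 2))) = 0" by (simp only:)
    hence "Re c = 0" using s by auto
    with Imc show False using c by (simp add: complex_eq_iff)
  qed
  have *: "Im c \<ge> 0" using closed[of 0] by simp
  have **: "Im (c * cis (of_int k * pi)) \<ge> 0" "Im (c * cis (of_int k * (pi / 2))) \<ge> 0"
    using closed[of pi] closed[of "pi/2"] by auto
  consider "k = -1" | "k = 0" | "k = 1" using small by linarith
  thus ?thesis
  proof cases
    case 1
    hence "Im c = 0" "Re c \<le> 0" using * ** by simp_all
    moreover have "Re c \<noteq> 0" using c \<open>Im c = 0\<close> by (simp add: complex_eq_iff)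
    ultimately show ?thesis using 1 by (simp add: complex_is_Real_iff)
  next
    case 2
    thus ?thesis using * by simp
  next
    case 3
    hence "Im c = 0" "Re c \<ge> 0" using * ** by simp_all
    moreover have "Re c \<noteq> 0" using c \<open>Im c = 0\<close> by (simp add: complex_eq_iff)
    ultimately show ?thesis using 3 by (simp add: complex_is_Real_iff)
  qed
qed

text \<open>
  The equation says that \<open>M\<close> behaves like \<open>v0 / u0 * (z - x) ^ (n - p)\<close> at \<open>x\<close>, written without
  negative exponents. Along the ray \<open>x + s * cis \<theta>\<close> the scaled values of \<open>M\<close> tend to
  \<open>v0 / u0 * cis ((n - p) * \<theta>)\<close>, which therefore stays in the closed upper half-plane.
\<close>

lemma boundary_order:
  fixes M u v :: "complex \<Rightarrow> complex" and x :: real and n p :: nat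
  assumes M: "\<And>z. Im z > 0 \<Longrightarrow> Im (M z) \<ge> 0"
    and eq: "eventually (\<lambda>z. M z * (z - of_real x) ^ p * u z = (z - of_real x) ^ n * v z) (at (of_real x) within \<complex>\<^sup>+)"
    and u: "(u \<longlongrightarrow> u0) (at (of_real x) within \<complex>\<^sup>+)" "u0 \<noteq> 0"
    and v: "(v \<longlongrightarrow> v0) (at (of_real x) within \<complex>\<^sup>+)" "v0 \<noteq> 0"
  shows "n + 1 = p \<and> v0 / u0 \<in> \<real> \<and> Re (v0 / u0) < 0 \<or> n = p \<and> Im (v0 / u0) \<ge> 0 \<or>
         n = p + 1 \<and> v0 / u0 \<in> \<real> \<and> Re (v0 / u0) > 0"
proof -
  define k where "k = int n - int p"
  have "k = -1 \<and> v0 / u0 \<in> \<real> \<and> Re (v0 / u0) < 0 \<or> k = 0 \<and> Im (v0 / u0) \<ge> 0 \<or> k = 1 \<and> v0 / u0 \<in> \<real> \<and> Re (v0 / u0) > 0"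
  proof (rule int_multiple_of_sector_in_half_plane)
    show "v0 / u0 \<noteq> 0" using u v by simp
    fix \<theta> :: real assume \<theta>: "0 < \<theta>" "\<theta> < pi"
    define z where "z s = of_real x + of_real s * cis \<theta>" for s :: real
    have Imz: "Im (z s) > 0" if "s > 0" for s
      using that \<theta> by (simp add: z_def sin_gt_zero)
    have "(z \<longlongrightarrow> of_real x + of_real 0 * cis \<theta>) (at_right 0)"
      unfolding z_def by (intro tendsto_intros)
    hence lim: "filterlim z (at (of_real x) within \<complex>\<^sup>+) (at_right 0)"
    proof -
      have "eventually (\<lambda>s. z s \<in> \<complex>\<^sup>+ \<and> z s \<noteq> of_real x) (at_right 0)"
        using eventually_at_right_less[of "0::real"]
        by eventually_elim (use Imz in force)
      moreover assume "(z \<longlongrightarrow> of_real x + of_real 0 * cis \<theta>) (at_right 0)"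
      ultimately show ?thesis unfolding filterlim_at by simp
    qed
    have "((\<lambda>s. Im (v (z s) / u (z s) * cis (of_int k * \<theta>))) \<longlongrightarrow> Im (v0 / u0 * cis (of_int k * \<theta>))) (at_right 0)"
      by (intro tendsto_intros filterlim_compose[OF u(1) lim] filterlim_compose[OF v(1) lim] u(2))
    moreover have "eventually (\<lambda>s. Im (v (z s) / u (z s) * cis (of_int k * \<theta>)) \<ge> 0) (at_right 0)"
    proof -
      have "eventually (\<lambda>s. M (z s) * (z s - of_real x) ^ p * u (z s) = (z s - of_real x) ^ n * v (z s)) (at_right 0)"
        by (rule eventually_compose_filterlim[OF eq lim])
      moreover have "eventually (\<lambda>s. u (z s) \<noteq> 0) (at_right 0)"
        using tendsto_imp_eventually_ne[OF filterlim_compose[OF u(1) lim] u(2)] .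
      moreover have "eventually (\<lambda>s::real. s > 0) (at_right 0)"
        by (simp add: eventually_at_right_less)
      ultimately show ?thesis
      proof eventually_elim
        case (elim s)
        define w where "w = v (z s) / u (z s) * cis (of_int k * \<theta>)"
        have cis: "cis (of_int k * \<theta>) * cis \<theta> ^ p = cis \<theta> ^ n"
          by (simp add: Complex.DeMoivre cis_mult k_def algebra_simps)
        have "of_real (s ^ n) * (v (z s) / u (z s) * cis (of_int k * \<theta>)) * cis \<theta> ^ p = ((z s - of_real x) ^ n * v (z s)) / u (z s)"
          using cis by (simp add: z_def power_mult_distrib)
        also have "\<dots> = M (z s) * (z s - of_real x) ^ p" using elim by (simp flip: elim(1))
        also have "\<dots> = of_real (s ^ p) * M (z s) * cis \<theta> ^ p" by (simp add: z_def power_mult_distrib)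
        finally have "of_real (s ^ n) * w * cis \<theta> ^ p = of_real (s ^ p) * M (z s) * cis \<theta> ^ p"
          unfolding w_def .
        moreover have "cis \<theta> ^ p \<noteq> 0" by simp
        ultimately have "of_real (s ^ n) * w = of_real (s ^ p) * M (z s)"
          using mult_right_cancel by blast
        hence "Im (of_real (s ^ n) * w) = Im (of_real (s ^ p) * M (z s))"
          by (rule arg_cong)
        hence "s ^ n * Im w = s ^ p * Im (M (z s))"
          by (simp only: Im_complex_of_real Re_complex_of_real times_complex.sel mult_zero_left add_0_right)
        moreover have "s ^ p * Im (M (z s)) \<ge> 0" using M[OF Imz] elim by simp
        ultimately have "s ^ n * 0 \<le> s ^ n * Im w" by simp
        hence "0 \<le> Im w" by (rule mult_left_le_imp_le) (use elim in simp)
        thus ?case unfolding w_def .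
      qed
    qed
    ultimately show "Im (v0 / u0 * cis (of_int k * \<theta>)) \<ge> 0"
      by (intro tendsto_lowerbound[of _ _ "at_right 0"]) auto
  qed
  thus ?thesis unfolding k_def by force
qed

section \<open>Nevanlinna functions and the rational factor\<close>

lemma nevanlinnaD:
  assumes "nevanlinna M"
  shows "M holomorphic_on \<complex>\<^sup>+" "Im z > 0 \<Longrightarrow> Im (M z) \<ge> 0"
proof -
  have "\<complex>\<^sup>+ \<subseteq> - \<real>" by (auto simp: complex_is_Real_iff)
  thus "M holomorphic_on \<complex>\<^sup>+"
    using assms unfolding nevanlinna_def by (meson holomorphic_on_subset)
  assume "Im z > 0"
  hence "M z \<in> \<complex>\<^sup>+ \<union> \<real>" using assms unfolding nevanlinna_def by blast
  thus "Im (M z) \<ge> 0" by (auto simp: complex_is_Real_iff)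
qed

lemma open_upper_half_plane: "open \<complex>\<^sup>+"
  by (rule open_halfspace_Im_gt)

lemma connected_upper_half_plane: "connected \<complex>\<^sup>+"
  by (intro convex_connected convex_halfspace_Im_gt)

text \<open>
  By the open mapping theorem a nonconstant \<open>M\<close> would also take values below a real value.
\<close>

lemma nevanlinna_real_value_imp_constant:
  assumes M: "nevanlinna M" and z: "Im z > 0" "Im (M z) = 0" and w: "Im w > 0"
  shows "M w = M z"
proof (rule ccontr)
  assume ne: "M w \<noteq> M z"
  have "\<not> M constant_on \<complex>\<^sup>+"
    using ne z(1) w by (auto simp: constant_on_def)
  hence "open (M ` \<complex>\<^sup>+)"
    by (intro open_mapping_thm[OF nevanlinnaD(1)[OF M] open_upper_half_plane connected_upper_half_plane open_upper_half_plane]) auto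
  moreover have "M z \<in> M ` \<complex>\<^sup>+" using z by auto
  ultimately obtain e where e: "e > 0" "cball (M z) e \<subseteq> M ` \<complex>\<^sup>+"
    unfolding open_contains_cball by blast
  have "M z - \<i> * of_real e \<in> cball (M z) e" using e(1) by (simp add: dist_norm norm_mult)
  hence "M z - \<i> * of_real e \<in> M ` \<complex>\<^sup>+" using e(2) by blast
  then obtain y where "M y = M z - \<i> * of_real e" "Im y > 0" by (elim imageE CollectE) (rule that[OF sym])
  moreover from this(2) have "Im (M y) \<ge> 0" by (rule nevanlinnaD(2)[OF M])
  ultimately show False using z(2) e(1) by simp
qed

lemma quad_factor_Some: "quad_factor (Some c) z = (z - c) * (z - cnj c)"
  by (simp add: quad_factor_def)

lemma quad_factor_holomorphic [holomorphic_intros]: "quad_factor a holomorphic_on S"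
  by (cases a) (auto simp: quad_factor_def [abs_def] intro!: holomorphic_intros)

lemma isCont_quad_factor: "isCont (quad_factor a) z"
  using holomorphic_on_imp_continuous_on[OF quad_factor_holomorphic[of a UNIV]]
  by (simp add: continuous_on_eq_continuous_at)

lemma quad_factor_real_pos:
  assumes "a \<noteq> Some (of_real x)"
  obtains r where "r > 0" "quad_factor a (of_real x) = of_real r"
proof (cases a)
  case None
  thus ?thesis using that[of 1] by (simp add: quad_factor_def)
next
  case (Some c)
  have "quad_factor a (of_real x) = of_real ((cmod (of_real x - c))\<^sup>2)"
    by (simp only: complex_norm_square) (simp add: Some quad_factor_def)
  moreover have "(cmod (of_real x - c))\<^sup>2 > 0" using assms Some by auto
  ultimately show ?thesis using that by blast
qed

lemma quad_factor_eq_0_upper: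
  assumes "a \<in> ext_closed_upper_half_plane" "Im z > 0" "quad_factor a z = 0"
  shows "a = Some z"
proof -
  obtain c where c: "a = Some c" "Im c \<ge> 0"
    using assms by (cases a) (auto simp: ext_closed_upper_half_plane_def quad_factor_def complex_is_Real_iff)
  hence "z = c \<or> z = cnj c" using assms(3) by (simp add: quad_factor_def)
  thus ?thesis using c assms(2) by auto
qed

lemma quad_factor_nonzero_cosparse:
  "\<forall>\<^sub>\<approx>z\<in>S. quad_factor a z \<noteq> 0"
proof -
  have "finite {z. quad_factor a z = 0}"
  proof (cases a)
    case (Some c)
    have "{z. quad_factor a z = 0} \<subseteq> {c, cnj c}" by (auto simp: Some quad_factor_def)
    thus ?thesis by (rule finite_subset) simp
  qed (simp add: quad_factor_def)
  thus ?thesis by (simp add: eventually_cosparse finite_imp_sparse)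
qed

lemma isCont_nevanlinna: "nevanlinna M \<Longrightarrow> Im z > 0 \<Longrightarrow> isCont M z"
  using holomorphic_on_imp_continuous_on[OF nevanlinnaD(1)]
  by (simp add: continuous_on_eq_continuous_at[OF open_upper_half_plane])

lemma of_real_one_plus_square: "1 + complex_of_real \<tau> * of_real \<tau> = of_real (1 + \<tau>\<^sup>2)" "1 + \<tau>\<^sup>2 > (0::real)"
  by (simp_all add: power2_eq_square add_pos_nonneg)

lemma tendsto_quad_factor: "(quad_factor a \<longlongrightarrow> quad_factor a z) (at z within S)"
  using isCont_quad_factor[of z a] unfolding isCont_def by (rule tendsto_within_subset) simp

text \<open>
  The root \<open>(w - \<xi>) * g w\<close> of \<open>f - f \<xi>\<close> is the local coordinate in which the solutions of \<open>f w = t\<close>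
  become roots of unity. The last conclusion links \<open>g\<close> to the derivatives of \<open>f\<close>, by the Leibniz rule.
\<close>

lemma leading_coefficient_of_power:
  fixes f :: "complex \<Rightarrow> complex"
  assumes f: "f holomorphic_on S" "open S" "\<xi> \<in> S" and n: "n > 0"
    and nz: "(deriv ^^ n) f \<xi> \<noteq> 0" and lower: "\<And>i. 0 < i \<Longrightarrow> i < n \<Longrightarrow> (deriv ^^ i) f \<xi> = 0"
  obtains g r where "r > 0" "ball \<xi> r \<subseteq> S" "g holomorphic_on ball \<xi> r"
    "\<And>w. w \<in> ball \<xi> r \<Longrightarrow> f w - f \<xi> = ((w - \<xi>) * g w) ^ n" "g \<xi> \<noteq> 0"
    "(deriv ^^ n) f \<xi> = fact n * g \<xi> ^ n"
proof (rule holomorphic_factor_order_of_zero_strong[OF f n nz])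
  fix g r0 assume g: "r0 > 0" "g holomorphic_on ball \<xi> r0"
    "\<And>w. w \<in> ball \<xi> r0 \<Longrightarrow> f w - f \<xi> = ((w - \<xi>) * g w) ^ n" "\<And>w. w \<in> ball \<xi> r0 \<Longrightarrow> g w \<noteq> 0"
  obtain r1 where r1: "r1 > 0" "ball \<xi> r1 \<subseteq> S" using f(2,3) by (meson open_contains_ball)
  define r where "r = min r0 r1"
  have r: "r > 0" "ball \<xi> r \<subseteq> S" "ball \<xi> r \<subseteq> ball \<xi> r0" using r1 g(1) by (auto simp: r_def)
  have hol: "g holomorphic_on ball \<xi> r" using g(2) r(3) by (rule holomorphic_on_subset)
  have \<xi>: "\<xi> \<in> ball \<xi> r" using r by simp
  have monom_deriv: "(deriv ^^ i) (\<lambda>w. (w - \<xi>) ^ n) \<xi> = (if i = n then fact n else 0)" if "i \<le> n" for i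
    using that by (simp add: higher_deriv_power pochhammer_fact)
  have "(deriv ^^ n) f \<xi> = (deriv ^^ n) (\<lambda>w. f \<xi> + (w - \<xi>) ^ n * g w ^ n) \<xi>"
  proof (rule higher_deriv_transform_within_open[OF _ _ open_ball \<xi>])
    show "f holomorphic_on ball \<xi> r" using f(1) r(2) by (rule holomorphic_on_subset)
    show "f w = f \<xi> + (w - \<xi>) ^ n * g w ^ n" if "w \<in> ball \<xi> r" for w
    proof -
      have "f w - f \<xi> = (w - \<xi>) ^ n * g w ^ n"
        using g(3)[of w] that r(3) unfolding power_mult_distrib by blast
      thus ?thesis by (metis add.commute diff_add_cancel)
    qed
  qed (intro holomorphic_intros hol)
  also have "\<dots> = (deriv ^^ n) (\<lambda>w. f \<xi>) \<xi> + (deriv ^^ n) (\<lambda>w. (w - \<xi>) ^ n * g w ^ n) \<xi>"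
    by (rule higher_deriv_add[OF _ _ open_ball \<xi>]) (intro holomorphic_intros hol)+
  also have "(deriv ^^ n) (\<lambda>w. (w - \<xi>) ^ n * g w ^ n) \<xi> =
      (\<Sum>i = 0..n. of_nat (n choose i) * (deriv ^^ i) (\<lambda>w. (w - \<xi>) ^ n) \<xi> * (deriv ^^ (n - i)) (\<lambda>w. g w ^ n) \<xi>)"
    by (rule higher_deriv_mult[OF _ _ open_ball \<xi>]) (intro holomorphic_intros hol)+
  also have "\<dots> = (\<Sum>i = 0..n. if i = n then fact n * g \<xi> ^ n else 0)"
    by (intro sum.cong refl) (auto simp: monom_deriv)
  also have "(deriv ^^ n) (\<lambda>w. f \<xi>) \<xi> = 0" using n by simp
  finally have "(deriv ^^ n) f \<xi> = fact n * g \<xi> ^ n" by simp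
  moreover have "f w - f \<xi> = ((w - \<xi>) * g w) ^ n" if "w \<in> ball \<xi> r" for w
    using that r(3) by (intro g(3)) blast
  moreover have "g \<xi> \<noteq> 0" using g(1) by (intro g(4)) simp
  ultimately show ?thesis using r(1,2) hol by (intro that[of r g])
qed (rule lower)

section \<open>The factorizations near the point of extension\<close>

text \<open>
  A disk around \<open>z0\<close> replaces \<open>\<Omega>\<close>: its upper half is convex, so identities between holomorphic
  functions there follow from those on a smaller open set.
\<close>

locale holomorphic_boundary_extension =
  fixes Q Qt :: "complex \<Rightarrow> complex" and \<alpha> :: "real \<Rightarrow> complex option" and z0 r :: real
  assumes Q: "Q \<in> N1"
    and r: "r > 0"
    and hol: "Qt holomorphic_on ball (of_real z0) r"
    and ext: "\<And>z. z \<in> ball (of_real z0) r \<Longrightarrow> Im z > 0 \<Longrightarrow> Qt z = Q z"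
    and gznt: "\<And>\<tau>. is_gznt (Q_transform Q \<tau>) (\<alpha> \<tau>)"
begin

abbreviation W :: "complex set" where "W \<equiv> ball (of_real z0) r"
abbreviation H :: "complex set" where "H \<equiv> W \<inter> \<complex>\<^sup>+"

lemma open_H: "open H" and connected_H: "connected H" and H_nonempty: "H \<noteq> {}"
proof -
  show "open H" by (intro open_Int open_ball open_upper_half_plane)
  show "connected H" by (intro convex_connected convex_Int convex_ball convex_halfspace_Im_gt)
  have "of_real z0 + \<i> * of_real (r / 2) \<in> H" using r by (simp add: dist_norm norm_mult)
  thus "H \<noteq> {}" by blast
qed

lemma hol_H: "Qt holomorphic_on H"
  using hol by (rule holomorphic_on_subset) blast

lemma isCont_Qt: "z \<in> W \<Longrightarrow> isCont Qt z"
  using holomorphic_on_imp_continuous_on[OF hol] by (simp add: continuous_on_eq_continuous_at)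

lemma cosparse_H:
  assumes "\<forall>\<^sub>\<approx>z\<in>\<complex>\<^sup>+. P z"
  shows "\<forall>\<^sub>\<approx>z\<in>H. P z"
  using assms unfolding eventually_cosparse by (rule sparse_in_subset) (rule Int_lower2)

lemma eventually_in_H: "of_real x \<in> W \<Longrightarrow> eventually (\<lambda>z. z \<in> H) (at (of_real x) within \<complex>\<^sup>+)"
  using eventually_at_in_open'[of W "of_real x :: complex"]
  by (auto simp: eventually_at_filter elim: eventually_mono)

text \<open>
  The factorization is multiplied out so that it holds at every point, including poles of \<open>Q_\<tau>\<close> and
  of the rational factor. The point \<open>z1\<close> rules out that \<open>1 + \<tau> Qt\<close> vanishes identically;
  then the value \<open>x / 0 = 0\<close> in \<^const>\<open>Q_transform\<close> is met only on a sparse set.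
\<close>

lemma factorization_equation_if:
  assumes fact: "is_factorization (Q_transform Q \<tau>) a b M"
    and nz: "z1 \<in> H" "1 + of_real \<tau> * Qt z1 \<noteq> 0" and z: "z \<in> H"
  shows "(Qt z - of_real \<tau>) * quad_factor b z = (1 + of_real \<tau> * Qt z) * quad_factor a z * M z"
proof (rule eq_if_eventually_cosparse[OF _ z])
  have M: "nevanlinna M" using fact unfolding is_factorization_def by blast
  show "isCont (\<lambda>z. (Qt z - of_real \<tau>) * quad_factor b z) z"
       "isCont (\<lambda>z. (1 + of_real \<tau> * Qt z) * quad_factor a z * M z) z"
    using z by (auto intro!: continuous_intros isCont_Qt isCont_quad_factor isCont_nevanlinna[OF M])
  have "\<forall>\<^sub>\<approx>z\<in>H. 1 + of_real \<tau> * Qt z \<noteq> 0"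
    unfolding eventually_cosparse_open_eq[OF open_H]
  proof
    fix x assume x: "x \<in> H"
    have h: "(\<lambda>z. 1 + of_real \<tau> * Qt z) holomorphic_on H" by (intro holomorphic_intros hol_H)
    show "eventually (\<lambda>z. 1 + of_real \<tau> * Qt z \<noteq> 0) (at x)"
    proof (cases "1 + of_real \<tau> * Qt x = 0")
      case True
      obtain e where e: "e > 0" "\<And>z. z \<in> ball x e - {x} \<Longrightarrow> 1 + of_real \<tau> * Qt z \<noteq> 0"
        using isolated_zeros[OF h open_H connected_H x True nz] by metis
      thus ?thesis unfolding eventually_at by (intro exI[of _ e]) (auto simp: dist_commute)
    next
      case False
      have "isCont (\<lambda>z. 1 + of_real \<tau> * Qt z) x"
        using x by (intro continuous_intros isCont_Qt) auto
      thus ?thesis using False unfolding isCont_def by (rule tendsto_imp_eventually_ne)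
    qed
  qed
  moreover have "\<forall>\<^sub>\<approx>z\<in>H. Q_transform Q \<tau> z = quad_factor a z / quad_factor b z * M z"
    using fact unfolding is_factorization_def by (intro cosparse_H) blast
  moreover have "\<forall>\<^sub>\<approx>z\<in>H. z \<in> H" by (rule eventually_in_cosparse[OF order_refl open_H])
  ultimately show "\<forall>\<^sub>\<approx>z\<in>H. (Qt z - of_real \<tau>) * quad_factor b z = (1 + of_real \<tau> * Qt z) * quad_factor a z * M z"
    using quad_factor_nonzero_cosparse[of b H]
  proof eventually_elim
    case (elim z)
    have "Qt z = Q z" using elim(3) ext by blast
    thus ?case using elim(1,2,4) by (simp add: Q_transform_def field_simps)
  qed
qed

text \<open>
  The parameter \<open>\<tau> = 0\<close> gives a factorization of \<open>Q\<close> itself, through which a constant value of \<open>Qt\<close>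
  spreads from \<open>H\<close> to the whole upper half-plane. A real constant is a Nevanlinna function, so it
  is not in \<^const>\<open>N1\<close>.
\<close>

lemma not_real_constant:
  obtains z where "z \<in> H" "Qt z \<noteq> of_real c"
proof (rule ccontr)
  assume "\<not> thesis"
  hence const: "Qt z = of_real c" if "z \<in> H" for z using that \<open>\<And>z. z \<in> H \<Longrightarrow> Qt z \<noteq> of_real c \<Longrightarrow> thesis\<close> by blast
  obtain b M where fact: "is_factorization (Q_transform Q 0) (\<alpha> 0) b M"
    using gznt[of 0] unfolding is_gznt_def by blast
  have M: "nevanlinna M" using fact unfolding is_factorization_def by blast
  obtain z1 where z1: "z1 \<in> H" using H_nonempty by blast
  have eqH: "of_real c * quad_factor b z = quad_factor (\<alpha> 0) z * M z" if "z \<in> H" for z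
    using factorization_equation_if[OF fact z1 _ that] const[OF that] by simp
  have eq: "of_real c * quad_factor b z = quad_factor (\<alpha> 0) z * M z" if "z \<in> \<complex>\<^sup>+" for z
    by (rule analytic_continuation_open[OF open_H open_upper_half_plane H_nonempty connected_upper_half_plane _ _ _ eqH that])
       (auto intro!: holomorphic_intros nevanlinnaD(1)[OF M])
  have "\<forall>\<^sub>\<approx>z\<in>\<complex>\<^sup>+. Q_transform Q 0 z = quad_factor (\<alpha> 0) z / quad_factor b z * M z"
    using fact unfolding is_factorization_def by blast
  moreover have "\<forall>\<^sub>\<approx>z\<in>\<complex>\<^sup>+. z \<in> \<complex>\<^sup>+" by (rule eventually_in_cosparse[OF order_refl open_upper_half_plane])
  ultimately have "\<forall>\<^sub>\<approx>z\<in>\<complex>\<^sup>+. Q z = of_real c"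
    using quad_factor_nonzero_cosparse[of b "\<complex>\<^sup>+"]
  proof eventually_elim
    case (elim z)
    have "quad_factor (\<alpha> 0) z / quad_factor b z * M z = of_real c"
      using eq[OF elim(2)] elim(3) by (simp add: divide_eq_eq)
    thus ?case using elim(1) by (simp add: Q_transform_def)
  qed
  thus False by (intro N1_not_nevanlinna[OF Q, of "\<lambda>_. of_real c"]) auto
qed

lemma factorization_equation:
  assumes "is_factorization (Q_transform Q \<tau>) a b M" and "z \<in> H"
  shows "(Qt z - of_real \<tau>) * quad_factor b z = (1 + of_real \<tau> * Qt z) * quad_factor a z * M z"
proof -
  \<comment> \<open>For \<open>\<tau> = 0\<close> the number \<open>- 1 / \<tau>\<close> is \<open>0\<close>, and any point serves.\<close>
  obtain z1 where z1: "z1 \<in> H" "Qt z1 \<noteq> of_real (- 1 / \<tau>)" by (rule not_real_constant)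
  have "1 + of_real \<tau> * Qt z1 \<noteq> 0"
  proof
    assume eq: "1 + of_real \<tau> * Qt z1 = 0"
    hence "\<tau> \<noteq> 0" by auto
    hence "Qt z1 = (of_real \<tau> * Qt z1) / of_real \<tau>" by simp
    also have "of_real \<tau> * Qt z1 = -1" using eq by (simp add: add_eq_0_iff)
    finally have "Qt z1 = of_real (- 1 / \<tau>)" by simp
    with z1(2) show False by contradiction
  qed
  from factorization_equation_if[OF assms(1) z1(1) this assms(2)] show ?thesis .
qed

lemma obtain_factorization:
  obtains b M where "is_factorization (Q_transform Q \<tau>) (\<alpha> \<tau>) b M" "nevanlinna M"
    "\<alpha> \<tau> \<in> ext_closed_upper_half_plane" "b \<in> ext_closed_upper_half_plane"
    "\<forall>z\<in>H. (Qt z - of_real \<tau>) * quad_factor b z = (1 + of_real \<tau> * Qt z) * quad_factor (\<alpha> \<tau>) z * M z"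
proof -
  obtain b M where fact: "is_factorization (Q_transform Q \<tau>) (\<alpha> \<tau>) b M"
    using gznt[of \<tau>] unfolding is_gznt_def by blast
  from fact have "nevanlinna M \<and> \<alpha> \<tau> \<in> ext_closed_upper_half_plane \<and> b \<in> ext_closed_upper_half_plane"
    unfolding is_factorization_def by blast
  thus ?thesis using that fact factorization_equation[OF fact] by blast
qed

lemma not_real_constant_off_zeros:
  obtains z where "z \<in> H" "quad_factor b z \<noteq> 0" "Qt z \<noteq> of_real c"
proof -
  obtain z2 where z2: "z2 \<in> H" "Qt z2 \<noteq> of_real c" by (rule not_real_constant)
  have "eventually (\<lambda>z. z \<in> H) (at z2)" using eventually_at_in_open'[OF open_H z2(1)] .
  moreover have "eventually (\<lambda>z. quad_factor b z \<noteq> 0) (at z2)"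
    using eventually_cosparse_imp_eventually_at[OF quad_factor_nonzero_cosparse z2(1)] .
  moreover have "eventually (\<lambda>z. Qt z \<noteq> of_real c) (at z2)"
    using isCont_Qt[of z2] z2 unfolding isCont_def by (intro tendsto_imp_eventually_ne) auto
  ultimately have "eventually (\<lambda>z. z \<in> H \<and> quad_factor b z \<noteq> 0 \<and> Qt z \<noteq> of_real c) (at z2)"
    by eventually_elim blast
  thus ?thesis using that eventually_happens'[OF at_neq_bot] by blast
qed

text \<open>
  If the two coincide, then \<open>Q_\<tau> = M\<close>, and undoing the linear fractional transformation, which
  preserves the upper half-plane, exhibits \<open>Q\<close> as a Nevanlinna function. A real constant \<open>M\<close> has to
  be treated apart, since then the inverse transformation may have a pole.
\<close>

lemma gznt_ne_gpnt:
  assumes fact: "is_factorization (Q_transform Q \<tau>) a b M"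
  shows "a \<noteq> b"
proof
  assume ab: "a = b"
  have M: "nevanlinna M" using fact unfolding is_factorization_def by blast
  have QM: "\<forall>\<^sub>\<approx>z\<in>\<complex>\<^sup>+. Q_transform Q \<tau> z = M z"
  proof -
    have "\<forall>\<^sub>\<approx>z\<in>\<complex>\<^sup>+. Q_transform Q \<tau> z = quad_factor a z / quad_factor b z * M z"
      using fact unfolding is_factorization_def by blast
    thus ?thesis using quad_factor_nonzero_cosparse[of b "\<complex>\<^sup>+"]
      by eventually_elim (simp add: ab)
  qed
  show False
  proof (cases "\<exists>z1. Im z1 > 0 \<and> Im (M z1) = 0")
    case True
    then obtain z1 where z1: "Im z1 > 0" "Im (M z1) = 0" by blast
    define m where "m = Re (M z1)"
    have Mm: "M z = of_real m" if "Im z > 0" for z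
      using nevanlinna_real_value_imp_constant[OF M z1 that] z1 by (simp add: m_def complex_eq_iff)
    obtain z where z: "z \<in> H" "quad_factor b z \<noteq> 0" "Qt z \<noteq> of_real ((m + \<tau>) / (1 - \<tau> * m))"
      by (rule not_real_constant_off_zeros)
    have "(Qt z - of_real \<tau>) * quad_factor b z = (1 + of_real \<tau> * Qt z) * M z * quad_factor b z"
      using factorization_equation[OF fact z(1)] by (simp only: ab mult_ac)
    hence "Qt z - of_real \<tau> = (1 + of_real \<tau> * Qt z) * of_real m"
      using z(1,2) Mm[of z] by simp
    hence eq: "Qt z * (1 - of_real (\<tau> * m)) = of_real (m + \<tau>)"
      by (simp add: algebra_simps)
    have "1 - \<tau> * m \<noteq> 0"
    proof
      assume *: "1 - \<tau> * m = 0"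
      hence "1 - complex_of_real (\<tau> * m) = 0" by simp
      hence "m + \<tau> = 0" using eq by (metis mult_zero_right of_real_eq_0_iff)
      \<comment> \<open>From \<open>\<tau> m = 1\<close> and \<open>m = - \<tau>\<close> it would follow that \<open>\<tau>\<^sup>2 = - 1\<close>.\<close>
      hence "\<tau> * m = - (\<tau> * \<tau>)" by (simp add: eq_neg_iff_add_eq_0 flip: distrib_left)
      moreover have "\<tau> * \<tau> \<ge> 0" by simp
      ultimately show False using * by linarith
    qed
    hence "1 - complex_of_real (\<tau> * m) \<noteq> 0" by (metis of_real_1 of_real_diff of_real_eq_0_iff)
    hence "Qt z = of_real ((m + \<tau>) / (1 - \<tau> * m))" using eq by (simp add: eq_divide_eq)
    with z(3) show False by contradiction
  next
    case False
    have ImM: "Im (M z) > 0" if "Im z > 0" for z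
      using nevanlinnaD(2)[OF M that] False that by force
    have nz: "1 - of_real \<tau> * M z \<noteq> 0" if "Im z > 0" for z
    proof
      assume "1 - of_real \<tau> * M z = 0"
      hence "Re (1 - of_real \<tau> * M z) = 0" "Im (1 - of_real \<tau> * M z) = 0" by simp_all
      thus False using ImM[OF that] by (auto simp: )
    qed
    define F where "F z = (M z + of_real \<tau>) / (1 - of_real \<tau> * M z)" for z
    show False
    proof (rule N1_not_nevanlinna[OF Q, of F])
      show "F holomorphic_on \<complex>\<^sup>+"
        unfolding F_def using nz by (intro holomorphic_intros nevanlinnaD(1)[OF M]) auto
      show "Im (F z) \<ge> 0" if "Im z > 0" for z
      proof -
        have "Im (M z + of_real \<tau>) * Re (1 - of_real \<tau> * M z) - Re (M z + of_real \<tau>) * Im (1 - of_real \<tau> * M z)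
            = Im (M z) * (1 + \<tau>\<^sup>2)"
          by (simp add: power2_eq_square algebra_simps)
        thus ?thesis using ImM[OF that] unfolding F_def Im_divide by simp
      qed
      have "\<forall>\<^sub>\<approx>z\<in>\<complex>\<^sup>+. z \<in> \<complex>\<^sup>+" by (rule eventually_in_cosparse[OF order_refl open_upper_half_plane])
      with QM show "\<forall>\<^sub>\<approx>z\<in>\<complex>\<^sup>+. Q z = F z"
      proof eventually_elim
        case (elim z)
        hence z: "Im z > 0" by simp
        have "M z \<noteq> 0" using ImM[OF z] by auto
        hence ne: "1 + of_real \<tau> * Q z \<noteq> 0" using elim(1) by (auto simp: Q_transform_def)
        hence "Q z - of_real \<tau> = M z * (1 + of_real \<tau> * Q z)"
          using elim(1) by (simp add: Q_transform_def divide_eq_eq)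
        hence "Q z * (1 - of_real \<tau> * M z) = M z + of_real \<tau>" by (simp add: algebra_simps)
        thus "Q z = F z" unfolding F_def using nz[OF z] by (simp add: eq_divide_eq)
      qed
    qed
  qed
qed

text \<open>
  At \<open>z1\<close> the multiplied factorization reads \<open>0 = (1 + \<tau>\<^sup>2) * quad_factor (\<alpha> \<tau>) z1 * M z1\<close>, and \<open>M\<close>
  vanishes at one point only if it vanishes identically, which would make \<open>Qt\<close> constant.
\<close>

lemma gznt_eq_interior_solution:
  assumes z1: "z1 \<in> H" "Qt z1 = of_real \<tau>"
  shows "\<alpha> \<tau> = Some z1"
proof -
  obtain b M where fact: "is_factorization (Q_transform Q \<tau>) (\<alpha> \<tau>) b M" "nevanlinna M"
    "\<alpha> \<tau> \<in> ext_closed_upper_half_plane" "b \<in> ext_closed_upper_half_plane"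
    and eqA: "\<forall>z\<in>H. (Qt z - of_real \<tau>) * quad_factor b z = (1 + of_real \<tau> * Qt z) * quad_factor (\<alpha> \<tau>) z * M z"
    by (rule obtain_factorization)
  note eq = eqA[rule_format]
  have "M z1 \<noteq> 0"
  proof
    assume M0: "M z1 = 0"
    have zero: "M z = 0" if "z \<in> H" for z
      using nevanlinna_real_value_imp_constant[OF fact(2), of z1 z] M0 z1 that by simp
    obtain z where z: "z \<in> H" "quad_factor b z \<noteq> 0" "Qt z \<noteq> of_real \<tau>"
      by (rule not_real_constant_off_zeros)
    show False using eq[OF z(1)] z zero[OF z(1)] by simp
  qed
  moreover have "complex_of_real (1 + \<tau>\<^sup>2) \<noteq> 0"
    using of_real_one_plus_square(2)[of \<tau>] by (metis less_irrefl of_real_eq_0_iff)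
  moreover have "complex_of_real (1 + \<tau>\<^sup>2) * quad_factor (\<alpha> \<tau>) z1 * M z1 = 0"
    using eq[OF z1(1)] unfolding z1(2) of_real_one_plus_square(1) by simp
  ultimately have "quad_factor (\<alpha> \<tau>) z1 = 0" by simp
  thus ?thesis using quad_factor_eq_0_upper[OF fact(3)] z1 by simp
qed

lemma tendsto_Qt:
  assumes "z \<in> W"
  shows "(Qt \<longlongrightarrow> Qt z) (at z within S)"
  using isCont_Qt[OF assms] unfolding isCont_def by (rule tendsto_within_subset) simp

text \<open>
  If \<open>x\<close> is not the generalized zero, then \<open>M\<close> is of order \<open>1\<close> at \<open>x\<close> with a negative coefficient, or
  of order \<open>3\<close> when \<open>x\<close> is the generalized pole; \<open>boundary_order\<close> excludes both.
\<close>

lemma gznt_eq_boundary_solution: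
  assumes x: "of_real x \<in> W" "Qt (of_real x) = of_real \<tau>"
    and d: "deriv Qt (of_real x) \<in> \<real>" "Re (deriv Qt (of_real x)) < 0"
  shows "\<alpha> \<tau> = Some (of_real x)"
proof (rule ccontr)
  assume a: "\<alpha> \<tau> \<noteq> Some (of_real x)"
  define D where "D = Re (deriv Qt (of_real x))"
  have D: "deriv Qt (of_real x) = of_real D" "D < 0" using d by (simp_all add: D_def)
  obtain b M where fact: "is_factorization (Q_transform Q \<tau>) (\<alpha> \<tau>) b M" "nevanlinna M"
    "\<alpha> \<tau> \<in> ext_closed_upper_half_plane" "b \<in> ext_closed_upper_half_plane"
    and eqA: "\<forall>z\<in>H. (Qt z - of_real \<tau>) * quad_factor b z = (1 + of_real \<tau> * Qt z) * quad_factor (\<alpha> \<tau>) z * M z"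
    by (rule obtain_factorization)
  note eq = eqA[rule_format]
  obtain A where A: "A > 0" "quad_factor (\<alpha> \<tau>) (of_real x) = of_real A"
    using quad_factor_real_pos[OF a] by blast
  define u where "u z = (1 + of_real \<tau> * Qt z) * quad_factor (\<alpha> \<tau>) z" for z
  define e where "e z = (Qt z - of_real \<tau>) / (z - of_real x)" for z
  define C where "C = (1 + \<tau>\<^sup>2) * A"
  have C: "C > 0" unfolding C_def using A(1) of_real_one_plus_square(2) by simp
  have "(u \<longlongrightarrow> (1 + of_real \<tau> * Qt (of_real x)) * quad_factor (\<alpha> \<tau>) (of_real x)) (at (of_real x) within \<complex>\<^sup>+)"
    unfolding u_def by (intro tendsto_intros tendsto_Qt tendsto_quad_factor x)
  also have "(1 + of_real \<tau> * Qt (of_real x)) * quad_factor (\<alpha> \<tau>) (of_real x) = of_real C"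
    unfolding x(2) A(2) C_def of_real_one_plus_square(1) by simp
  finally have u: "(u \<longlongrightarrow> of_real C) (at (of_real x) within \<complex>\<^sup>+)" .
  have u0: "complex_of_real C \<noteq> 0" using C by simp
  have "(Qt has_field_derivative of_real D) (at (of_real x))"
    using holomorphic_derivI[OF hol open_ball x(1)] D(1) by simp
  hence "(e \<longlongrightarrow> of_real D) (at (of_real x))"
    unfolding e_def has_field_derivative_iff x(2) .
  hence e: "(e \<longlongrightarrow> of_real D) (at (of_real x) within \<complex>\<^sup>+)"
    by (rule tendsto_within_subset) simp
  have ne: "z - of_real x \<noteq> 0" if "z \<in> H" for z using that by auto
  note ord = boundary_order[OF nevanlinnaD(2)[OF fact(2)] _ u u0]
  show False
  proof (cases "b = Some (of_real x)")
    case True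
    have "eventually (\<lambda>z. M z * (z - of_real x) ^ 0 * u z = (z - of_real x) ^ 3 * e z) (at (of_real x) within \<complex>\<^sup>+)"
      using eventually_in_H[OF x(1)]
    proof eventually_elim
      case (elim z)
      show ?case using eq[OF elim] ne[OF elim]
        by (simp add: True quad_factor_Some e_def u_def power3_eq_cube mult_ac)
    qed
    from ord[OF _ this e] show False using D(2) by simp
  next
    case False
    then obtain B where B: "B > 0" "quad_factor b (of_real x) = of_real B"
      using quad_factor_real_pos by blast
    have ev: "eventually (\<lambda>z. M z * (z - of_real x) ^ 0 * u z = (z - of_real x) ^ 1 * (e z * quad_factor b z)) (at (of_real x) within \<complex>\<^sup>+)"
      using eventually_in_H[OF x(1)]
    proof eventually_elim
      case (elim z)
      show ?case using eq[OF elim] ne[OF elim] by (simp add: e_def u_def mult_ac)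
    qed
    have "((\<lambda>z. e z * quad_factor b z) \<longlongrightarrow> of_real D * quad_factor b (of_real x)) (at (of_real x) within \<complex>\<^sup>+)"
      by (intro tendsto_intros e tendsto_quad_factor)
    hence v: "((\<lambda>z. e z * quad_factor b z) \<longlongrightarrow> of_real (D * B)) (at (of_real x) within \<complex>\<^sup>+)"
      by (simp add: B(2))
    have "complex_of_real (D * B) \<noteq> 0" using D(2) B(1) by simp
    from ord[OF _ ev v this] have "Re (of_real (D * B) / of_real C) > 0" by simp
    hence "D * B / C > 0" by (simp flip: of_real_divide)
    moreover have "D * B / C < 0" using D(2) B(1) C by (intro divide_neg_pos mult_neg_pos)
    ultimately show False by simp
  qed
qed

lemma finite_order:
  assumes c: "Qt (of_real z0) = of_real c"
  obtains n g \<rho> where "n > 0" "\<forall>i. 0 < i \<and> i < n \<longrightarrow> (deriv ^^ i) Qt (of_real z0) = 0"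
    "\<rho> > 0" "ball (of_real z0) \<rho> \<subseteq> W" "g holomorphic_on ball (of_real z0) \<rho>"
    "\<forall>w\<in>ball (of_real z0) \<rho>. Qt w - of_real c = ((w - of_real z0) * g w) ^ n" "g (of_real z0) \<noteq> 0"
    "(deriv ^^ n) Qt (of_real z0) = fact n * g (of_real z0) ^ n"
proof -
  have z0: "of_real z0 \<in> W" using r by simp
  have ex: "\<exists>n>0. (deriv ^^ n) Qt (of_real z0) \<noteq> 0"
  proof (rule ccontr)
    assume "\<not> ?thesis"
    hence d0: "(deriv ^^ n) Qt (of_real z0) = 0" if "n > 0" for n using that by blast
    have "Qt w = of_real c" if "w \<in> W" for w
      using holomorphic_fun_eq_const_on_connected[OF hol open_ball connected_ball d0 z0 that] c by simp
    moreover obtain z where "z \<in> H" "Qt z \<noteq> of_real c" by (rule not_real_constant)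
    ultimately show False by blast
  qed
  define n where "n = (LEAST n. n > 0 \<and> (deriv ^^ n) Qt (of_real z0) \<noteq> 0)"
  have n: "n > 0" "(deriv ^^ n) Qt (of_real z0) \<noteq> 0"
    using LeastI_ex[OF ex] unfolding n_def by blast+
  have lower: "(deriv ^^ i) Qt (of_real z0) = 0" if "0 < i" "i < n" for i
    using not_less_Least[of i "\<lambda>n. n > 0 \<and> (deriv ^^ n) Qt (of_real z0) \<noteq> 0"] that unfolding n_def by blast
  show ?thesis
  proof (rule leading_coefficient_of_power[OF hol open_ball z0 n])
    fix g \<rho>
    assume *: "\<rho> > 0" "ball (of_real z0) \<rho> \<subseteq> W" "g holomorphic_on ball (of_real z0) \<rho>"
      "\<And>w. w \<in> ball (of_real z0) \<rho> \<Longrightarrow> Qt w - Qt (of_real z0) = ((w - of_real z0) * g w) ^ n" "g (of_real z0) \<noteq> 0"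
      "(deriv ^^ n) Qt (of_real z0) = fact n * g (of_real z0) ^ n"
    have "\<forall>i. 0 < i \<and> i < n \<longrightarrow> (deriv ^^ i) Qt (of_real z0) = 0" using lower by simp
    moreover have "\<forall>w\<in>ball (of_real z0) \<rho>. Qt w - of_real c = ((w - of_real z0) * g w) ^ n"
      using *(4) unfolding c by simp
    ultimately show thesis using n(1) *(1,2,3,5,6) by (intro that[of n \<rho> g])
  qed (rule lower)
qed

text \<open>
  \<open>boundary_order\<close> is applied to \<open>M\<close>, which is of order \<open>n - 2\<close> at \<open>z0\<close>. The values of \<open>Qt z0\<close> other
  than \<open>\<tau>\<close> are excluded in the same way: they make \<open>Q_\<tau>\<close> nonzero or infinite at \<open>z0\<close>, so \<open>M\<close> has a
  pole there of order at least \<open>2\<close>.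
\<close>

lemma order_at_gznt:
  assumes \<alpha>: "\<alpha> \<tau> = Some (of_real z0)"
  obtains n g \<rho> where "Qt (of_real z0) = of_real \<tau>"
    "n > 0" "\<forall>i. 0 < i \<and> i < n \<longrightarrow> (deriv ^^ i) Qt (of_real z0) = 0"
    "\<rho> > 0" "ball (of_real z0) \<rho> \<subseteq> W" "g holomorphic_on ball (of_real z0) \<rho>"
    "\<forall>w\<in>ball (of_real z0) \<rho>. Qt w - of_real \<tau> = ((w - of_real z0) * g w) ^ n" "g (of_real z0) \<noteq> 0"
    "(deriv ^^ n) Qt (of_real z0) = fact n * g (of_real z0) ^ n"
    "n = 1 \<and> g (of_real z0) ^ n \<in> \<real> \<and> Re (g (of_real z0) ^ n) < 0 \<or>
     n = 2 \<and> Im (g (of_real z0) ^ n) \<ge> 0 \<or>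
     n = 3 \<and> g (of_real z0) ^ n \<in> \<real> \<and> Re (g (of_real z0) ^ n) > 0"
proof -
  let ?z = "complex_of_real z0"
  let ?F = "at ?z within \<complex>\<^sup>+"
  have z0: "?z \<in> W" using r by simp
  obtain b M where fact: "is_factorization (Q_transform Q \<tau>) (\<alpha> \<tau>) b M" "nevanlinna M"
    "\<alpha> \<tau> \<in> ext_closed_upper_half_plane" "b \<in> ext_closed_upper_half_plane"
    and eqA: "\<forall>z\<in>H. (Qt z - of_real \<tau>) * quad_factor b z = (1 + of_real \<tau> * Qt z) * quad_factor (\<alpha> \<tau>) z * M z"
    by (rule obtain_factorization)
  note eq0 = eqA[rule_format]
  have eq: "M z * (z - ?z)\<^sup>2 * (1 + of_real \<tau> * Qt z) = (Qt z - of_real \<tau>) * quad_factor b z" if "z \<in> H" for z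
    using eq0[OF that] by (simp add: \<alpha> quad_factor_Some power2_eq_square mult_ac)
  have "b \<noteq> Some ?z" using gznt_ne_gpnt[OF fact(1)] \<alpha> by metis
  then obtain B where B: "B > 0" "quad_factor b ?z = of_real B"
    using quad_factor_real_pos by blast
  have tb: "(quad_factor b \<longlongrightarrow> of_real B) ?F" using tendsto_quad_factor[of b ?z] B(2) by simp
  note ord = boundary_order[OF nevanlinnaD(2)[OF fact(2)]]
  have q0: "Qt ?z = of_real \<tau>"
  proof (rule ccontr)
    assume ne: "Qt ?z \<noteq> of_real \<tau>"
    have v: "((\<lambda>z. (Qt z - of_real \<tau>) * quad_factor b z) \<longlongrightarrow> (Qt ?z - of_real \<tau>) * of_real B) ?F"
      by (intro tendsto_intros tendsto_Qt[OF z0] tb)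
    have v0: "(Qt ?z - of_real \<tau>) * of_real B \<noteq> 0" using ne B(1) by simp
    show False
    proof (cases "1 + of_real \<tau> * Qt ?z = 0")
      case False
      have u: "((\<lambda>z. 1 + of_real \<tau> * Qt z) \<longlongrightarrow> 1 + of_real \<tau> * Qt ?z) ?F"
        by (intro tendsto_intros tendsto_Qt[OF z0])
      have "eventually (\<lambda>z. M z * (z - ?z) ^ 2 * (1 + of_real \<tau> * Qt z) = (z - ?z) ^ 0 * ((Qt z - of_real \<tau>) * quad_factor b z)) ?F"
        using eventually_in_H[OF z0] by eventually_elim (simp add: eq)
      from ord[OF _ this u False v v0] show False by simp
    next
      case True
      hence \<tau>: "\<tau> \<noteq> 0" by auto
      hence "Qt ?z = (of_real \<tau> * Qt ?z) / of_real \<tau>" by simp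
      also have "of_real \<tau> * Qt ?z = -1" using True by (simp add: add_eq_0_iff)
      finally have c: "Qt ?z = of_real (- 1 / \<tau>)" by simp
      obtain m g \<rho> where "m > 0" and "\<forall>i. 0 < i \<and> i < m \<longrightarrow> (deriv ^^ i) Qt ?z = 0"
        and mg: "\<rho> > 0" "ball ?z \<rho> \<subseteq> W" "g holomorphic_on ball ?z \<rho>"
        "\<forall>w\<in>ball ?z \<rho>. Qt w - of_real (- 1 / \<tau>) = ((w - ?z) * g w) ^ m" "g ?z \<noteq> 0"
        and "(deriv ^^ m) Qt ?z = fact m * g ?z ^ m"
        by (rule finite_order[OF c])
      have "isCont g ?z"
        using holomorphic_on_imp_continuous_on[OF mg(3)] mg(1) by (simp add: continuous_on_eq_continuous_at)
      hence "(g \<longlongrightarrow> g ?z) ?F" unfolding isCont_def by (rule tendsto_within_subset) simp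
      hence u: "((\<lambda>z. of_real \<tau> * g z ^ m) \<longlongrightarrow> of_real \<tau> * g ?z ^ m) ?F" by (intro tendsto_intros)
      have u0: "of_real \<tau> * g ?z ^ m \<noteq> 0" using \<tau> mg(5) by simp
      have "eventually (\<lambda>z. z \<in> ball ?z \<rho>) ?F"
        using mg(1) unfolding eventually_at by (intro exI[of _ \<rho>]) (auto simp: dist_commute)
      hence "eventually (\<lambda>z. M z * (z - ?z) ^ (2 + m) * (of_real \<tau> * g z ^ m) = (z - ?z) ^ 0 * ((Qt z - of_real \<tau>) * quad_factor b z)) ?F"
        using eventually_in_H[OF z0]
      proof eventually_elim
        case (elim z)
        have "1 + of_real \<tau> * Qt z = of_real \<tau> * (Qt z - of_real (- 1 / \<tau>))" using \<tau> by (simp add: algebra_simps)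
        also have "\<dots> = of_real \<tau> * ((z - ?z) ^ m * g z ^ m)"
          using mg(4) elim(1) unfolding power_mult_distrib by simp
        finally have key: "1 + of_real \<tau> * Qt z = of_real \<tau> * ((z - ?z) ^ m * g z ^ m)" .
        have "M z * (z - ?z) ^ (2 + m) * (of_real \<tau> * g z ^ m) = M z * (z - ?z)\<^sup>2 * (of_real \<tau> * ((z - ?z) ^ m * g z ^ m))"
          by (simp only: power_add mult_ac)
        also have "\<dots> = (Qt z - of_real \<tau>) * quad_factor b z"
          using eq[OF elim(2)] unfolding key .
        finally show ?case by simp
      qed
      from ord[OF _ this u u0 v v0] show False by simp
    qed
  qed
  obtain n g \<rho> where n: "n > 0" "\<forall>i. 0 < i \<and> i < n \<longrightarrow> (deriv ^^ i) Qt ?z = 0"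
    and g: "\<rho> > 0" "ball ?z \<rho> \<subseteq> W" "g holomorphic_on ball ?z \<rho>"
    "\<forall>w\<in>ball ?z \<rho>. Qt w - of_real \<tau> = ((w - ?z) * g w) ^ n" "g ?z \<noteq> 0"
    "(deriv ^^ n) Qt ?z = fact n * g ?z ^ n"
    by (rule finite_order[OF q0]) 
  define C where "C = B / (1 + \<tau>\<^sup>2)"
  have C: "C > 0" unfolding C_def using B(1) of_real_one_plus_square(2) by simp
  have "((\<lambda>z. 1 + of_real \<tau> * Qt z) \<longlongrightarrow> 1 + of_real \<tau> * Qt ?z) ?F"
    by (intro tendsto_intros tendsto_Qt[OF z0])
  hence u: "((\<lambda>z. 1 + of_real \<tau> * Qt z) \<longlongrightarrow> of_real (1 + \<tau>\<^sup>2)) ?F"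
    unfolding q0 of_real_one_plus_square(1) .
  have u0: "complex_of_real (1 + \<tau>\<^sup>2) \<noteq> 0"
    using of_real_one_plus_square(2)[of \<tau>] by (metis less_irrefl of_real_eq_0_iff)
  have "isCont g ?z"
    using holomorphic_on_imp_continuous_on[OF g(3)] g(1) by (simp add: continuous_on_eq_continuous_at)
  hence "(g \<longlongrightarrow> g ?z) ?F" unfolding isCont_def by (rule tendsto_within_subset) simp
  hence v: "((\<lambda>z. g z ^ n * quad_factor b z) \<longlongrightarrow> g ?z ^ n * of_real B) ?F" by (intro tendsto_intros tb)
  have v0: "g ?z ^ n * of_real B \<noteq> 0" using g(5) B(1) by simp
  have "eventually (\<lambda>z. z \<in> ball ?z \<rho>) ?F"
    using g(1) unfolding eventually_at by (intro exI[of _ \<rho>]) (auto simp: dist_commute)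
  hence ev: "eventually (\<lambda>z. M z * (z - ?z) ^ 2 * (1 + of_real \<tau> * Qt z) = (z - ?z) ^ n * (g z ^ n * quad_factor b z)) ?F"
    using eventually_in_H[OF z0]
  proof eventually_elim
    case (elim z)
    show ?case using eq[OF elim(2)] bspec[OF g(4) elim(1)] by (simp add: power_mult_distrib mult_ac)
  qed
  have ratio: "g ?z ^ n * of_real B / of_real (1 + \<tau>\<^sup>2) = of_real C * g ?z ^ n"
    by (simp add: C_def)
  define G where "G = g ?z ^ n"
  have "n + 1 = 2 \<and> of_real C * G \<in> \<real> \<and> Re (of_real C * G) < 0 \<or> n = 2 \<and> Im (of_real C * G) \<ge> 0 \<or>
      n = 2 + 1 \<and> of_real C * G \<in> \<real> \<and> Re (of_real C * G) > 0"
    using ord[OF _ ev u u0 v v0] unfolding ratio G_def by simp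
  hence "n = 1 \<and> G \<in> \<real> \<and> Re G < 0 \<or> n = 2 \<and> Im G \<ge> 0 \<or> n = 3 \<and> G \<in> \<real> \<and> Re G > 0"
    using C by (auto simp: complex_is_Real_iff mult_less_0_iff zero_less_mult_iff zero_le_mult_iff)
  from that[OF q0 n g this[unfolded G_def]] show ?thesis .
qed

text \<open>
  On the real axis the rational factor of \<open>Q\<close> is positive, so \<open>Im Qt\<close> inherits the sign of the
  boundary values of \<open>Im M\<close> (order \<open>0\<close> in \<open>boundary_order\<close>). The finitely many exceptional points,
  the generalized zero and pole of \<open>Q\<close>, are avoided by shrinking the interval around \<open>z0\<close>.
\<close>

lemma Im_nonneg_on_reals:
  assumes real: "Im (Qt (of_real z0)) = 0"
  obtains \<rho> where "\<rho> > 0" "\<rho> \<le> r" "\<And>x. \<bar>x - z0\<bar> < \<rho> \<Longrightarrow> Im (Qt (of_real x)) \<ge> 0"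
proof -
  obtain b M where fact: "is_factorization (Q_transform Q 0) (\<alpha> 0) b M" "nevanlinna M"
    "\<alpha> 0 \<in> ext_closed_upper_half_plane" "b \<in> ext_closed_upper_half_plane"
    and eqA: "\<forall>z\<in>H. (Qt z - of_real 0) * quad_factor b z = (1 + of_real 0 * Qt z) * quad_factor (\<alpha> 0) z * M z"
    by (rule obtain_factorization)
  note eq = eqA[rule_format]
  have nonneg: "Im (Qt (of_real x)) \<ge> 0" if x: "of_real x \<in> W" "\<alpha> 0 \<noteq> Some (of_real x)" "b \<noteq> Some (of_real x)" for x
  proof (cases "Qt (of_real x) = 0")
    case False
    obtain A where A: "A > 0" "quad_factor (\<alpha> 0) (of_real x) = of_real A"
      using quad_factor_real_pos[OF x(2)] by blast
    obtain B where B: "B > 0" "quad_factor b (of_real x) = of_real B"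
      using quad_factor_real_pos[OF x(3)] by blast
    have "((\<lambda>z. Qt z * quad_factor b z) \<longlongrightarrow> Qt (of_real x) * quad_factor b (of_real x)) (at (of_real x) within \<complex>\<^sup>+)"
      by (intro tendsto_intros tendsto_Qt[OF x(1)] tendsto_quad_factor)
    hence v: "((\<lambda>z. Qt z * quad_factor b z) \<longlongrightarrow> Qt (of_real x) * of_real B) (at (of_real x) within \<complex>\<^sup>+)"
      unfolding B(2) .
    have u: "(quad_factor (\<alpha> 0) \<longlongrightarrow> of_real A) (at (of_real x) within \<complex>\<^sup>+)"
      using tendsto_quad_factor[of "\<alpha> 0" "of_real x"] A(2) by simp
    have ev: "eventually (\<lambda>z. M z * (z - of_real x) ^ 0 * quad_factor (\<alpha> 0) z = (z - of_real x) ^ 0 * (Qt z * quad_factor b z)) (at (of_real x) within \<complex>\<^sup>+)"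
      using eventually_in_H[OF x(1)]
    proof eventually_elim
      case (elim z)
      show ?case using eq[OF elim] by (simp add: mult_ac)
    qed
    have "complex_of_real A \<noteq> 0" "Qt (of_real x) * of_real B \<noteq> 0" using A B False by auto
    from boundary_order[OF nevanlinnaD(2)[OF fact(2)] ev u this(1) v this(2)]
    have "Im (Qt (of_real x) * of_real B / of_real A) \<ge> 0" by simp
    hence "Im (Qt (of_real x)) * B / A \<ge> 0" by simp
    thus ?thesis using A(1) B(1) by (simp add: zero_le_divide_iff zero_le_mult_iff)
  qed simp
  define E where "E = {x. \<alpha> 0 = Some (complex_of_real x)} \<union> {x. b = Some (complex_of_real x)}"
  have "finite {x. a = Some (complex_of_real x)}" for a
  proof (rule finite_subset)
    show "{x. a = Some (complex_of_real x)} \<subseteq> {Re (the a)}" by auto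
  qed simp
  hence "finite E" unfolding E_def by simp
  then obtain d where d: "d > 0" "\<And>x. x \<in> E \<Longrightarrow> x \<noteq> z0 \<Longrightarrow> d \<le> dist z0 x"
    using finite_set_avoid by metis
  show ?thesis
  proof (rule that[of "min d r"])
    fix x assume x: "\<bar>x - z0\<bar> < min d r"
    show "Im (Qt (of_real x)) \<ge> 0"
    proof (cases "x = z0")
      case False
      hence "x \<notin> E" using d(2)[of x] x by (auto simp: dist_real_def)
      moreover have "of_real x \<in> W"
        using x by (simp add: dist_norm abs_minus_commute flip: of_real_diff)
      ultimately show ?thesis by (intro nonneg) (auto simp: E_def)
    qed (simp add: real)
  qed (use d(1) r in auto)
qed

end

section \<open>The branches of the solution set\<close>

text \<open>
  \<^const>\<open>Arg\<close> jumps across the negative axis, but its restriction to the closed upper half-plane is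
  continuous away from \<open>0\<close>, since there it agrees with \<^const>\<open>Arg2pi\<close>, whose jump lies
  on the positive axis and is seen only from below.
\<close>

lemma tendsto_Arg_closed_upper:
  assumes lim: "(F \<longlongrightarrow> e) net" and e: "e \<noteq> 0" and up: "eventually (\<lambda>x. Im (F x) \<ge> 0) net" and net: "net \<noteq> bot"
  shows "((\<lambda>x. Arg (F x)) \<longlongrightarrow> Arg e) net"
proof -
  have eq: "Arg z = Arg2pi z" if "Im z \<ge> 0" "z \<noteq> 0" for z
  proof (rule Arg_unique)
    show "of_real (cmod z) * exp (\<i> * of_real (Arg2pi z)) = z" using Arg2pi_eq[of z] by simp
    show "Arg2pi z \<le> pi" using Arg2pi_le_pi[of z] that by simp
    show "- pi < Arg2pi z" using Arg2pi_ge_0[of z] pi_gt_zero by linarith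
  qed (use that in simp)
  have Ime: "Im e \<ge> 0"
    using tendsto_lowerbound[OF tendsto_Im[OF lim] up net] .
  have ne: "eventually (\<lambda>x. F x \<noteq> 0) net" using tendsto_imp_eventually_ne[OF lim e] .
  have "((\<lambda>x. Arg2pi (F x)) \<longlongrightarrow> Arg2pi e) net"
  proof (rule continuous_within_tendsto_compose[OF continuous_within_upperhalf_Arg2pi[OF e] _ lim])
    show "eventually (\<lambda>x. F x \<in> {z. 0 \<le> Im z}) net" using up by simp
  qed
  moreover have "eventually (\<lambda>x. Arg2pi (F x) = Arg (F x)) net"
    using up ne by eventually_elim (simp add: eq)
  ultimately show ?thesis
    using eq[OF Ime e] by (simp add: tendsto_cong)
qed

lemma local_inverse_of_linear_factor:
  fixes g :: "complex \<Rightarrow> complex"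
  assumes \<rho>: "\<rho> > 0" and g: "g holomorphic_on ball a \<rho>" "g a \<noteq> 0"
  obtains \<psi> \<delta> where "\<delta> > 0" "\<psi> holomorphic_on ball 0 \<delta>" "\<psi> 0 = a"
    "\<forall>\<zeta>\<in>ball 0 \<delta>. \<psi> \<zeta> \<in> ball a \<rho> \<and> (\<psi> \<zeta> - a) * g (\<psi> \<zeta>) = \<zeta>"
    "(\<psi> has_field_derivative 1 / g a) (at 0)"
proof -
  define \<phi> where "\<phi> w = (w - a) * g w" for w
  have a: "a \<in> ball a \<rho>" using \<rho> by simp
  have hol: "\<phi> holomorphic_on ball a \<rho>" unfolding \<phi>_def by (intro holomorphic_intros g)
  have "(g has_field_derivative deriv g a) (at a)" using holomorphic_derivI[OF g(1) open_ball a] .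
  hence "(\<phi> has_field_derivative g a) (at a)"
    unfolding \<phi>_def by (auto intro!: derivative_eq_intros)
  hence d: "deriv \<phi> a = g a" by (rule DERIV_imp_deriv)
  obtain r where r: "r > 0" "ball a r \<subseteq> ball a \<rho>" "open (\<phi> ` ball a r)" "inj_on \<phi> (ball a r)"
    using has_complex_derivative_locally_invertible[OF hol a open_ball] d g(2) by metis
  have hol': "\<phi> holomorphic_on ball a r" using hol r(2) by (rule holomorphic_on_subset)
  have ar: "a \<in> ball a r" using r(1) by simp
  show ?thesis
  proof (rule holomorphic_has_inverse[OF hol' open_ball r(4)])
    fix \<psi> assume \<psi>: "\<psi> holomorphic_on \<phi> ` ball a r"
      "\<And>z. z \<in> ball a r \<Longrightarrow> deriv \<phi> z * deriv \<psi> (\<phi> z) = 1"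
      "\<And>z. z \<in> ball a r \<Longrightarrow> \<psi> (\<phi> z) = z"
    have \<phi>a: "\<phi> a = 0" by (simp add: \<phi>_def)
    have "0 \<in> \<phi> ` ball a r" using ar \<phi>a by (metis image_eqI)
    then obtain \<delta> where \<delta>: "\<delta> > 0" "ball 0 \<delta> \<subseteq> \<phi> ` ball a r"
      using r(3) open_contains_ball by metis
    have hol\<psi>: "\<psi> holomorphic_on ball 0 \<delta>" using \<psi>(1) \<delta>(2) by (rule holomorphic_on_subset)
    have "\<psi> \<zeta> \<in> ball a \<rho> \<and> (\<psi> \<zeta> - a) * g (\<psi> \<zeta>) = \<zeta>" if "\<zeta> \<in> ball 0 \<delta>" for \<zeta>
    proof -
      have "\<zeta> \<in> \<phi> ` ball a r" using \<delta>(2) that by (rule subsetD)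
      then obtain w where w: "w \<in> ball a r" "\<zeta> = \<phi> w" by (rule imageE)
      have "\<psi> \<zeta> = w" using \<psi>(3)[OF w(1)] w(2) by simp
      thus ?thesis using w r(2) unfolding \<phi>_def by (simp add: subset_iff)
    qed
    moreover have "(\<psi> has_field_derivative deriv \<psi> 0) (at 0)"
      using holomorphic_derivI[OF hol\<psi> open_ball, of 0] \<delta>(1) by simp
    moreover have "deriv \<psi> 0 = 1 / g a"
      using \<psi>(2)[OF ar] g(2) unfolding \<phi>a d by (simp add: eq_divide_eq mult.commute)
    moreover have "\<psi> 0 = a" using \<psi>(3)[OF ar] \<phi>a by simp
    ultimately show thesis using \<delta>(1) hol\<psi> by (intro that[of \<delta> \<psi>]) simp_all
  qed
qed

text \<open>
  Here \<open>f\<close> is the holomorphic extension, \<open>(w - z0) * g w\<close> an \<open>n\<close>-th root of \<open>f - \<tau>0\<close>, and \<open>\<psi>\<close> the local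
  inverse of that root, so that \<open>\<psi> (s * \<omega>)\<close> solves \<open>f w = \<tau>0 + (s * \<omega>) ^ n\<close>. Of the generalized zeros
  only the two ways to recognize them are kept.
\<close>

locale solution_branches =
  fixes f g \<psi> :: "complex \<Rightarrow> complex" and \<alpha> :: "real \<Rightarrow> complex option" and z0 \<tau>0 \<rho> \<delta> :: real and n :: nat
  assumes \<rho>: "\<rho> > 0" and n: "n > 0"
    and hol_f: "f holomorphic_on ball (of_real z0) \<rho>"
    and hol_g: "g holomorphic_on ball (of_real z0) \<rho>"
    and power: "\<And>w. w \<in> ball (of_real z0) \<rho> \<Longrightarrow> f w - of_real \<tau>0 = ((w - of_real z0) * g w) ^ n"
    and g0: "g (of_real z0) \<noteq> 0"
    and \<delta>: "\<delta> > 0" and hol_\<psi>: "\<psi> holomorphic_on ball 0 \<delta>" and \<psi>0: "\<psi> 0 = of_real z0"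
    and \<psi>_in: "\<And>\<zeta>. \<zeta> \<in> ball 0 \<delta> \<Longrightarrow> \<psi> \<zeta> \<in> ball (of_real z0) \<rho>"
    and \<psi>_eq: "\<And>\<zeta>. \<zeta> \<in> ball 0 \<delta> \<Longrightarrow> (\<psi> \<zeta> - of_real z0) * g (\<psi> \<zeta>) = \<zeta>"
    and \<psi>_deriv: "(\<psi> has_field_derivative 1 / g (of_real z0)) (at 0)"
    and interior: "\<And>z \<tau>. z \<in> ball (of_real z0) \<rho> \<Longrightarrow> Im z > 0 \<Longrightarrow> f z = of_real \<tau> \<Longrightarrow> \<alpha> \<tau> = Some z"
    and boundary: "\<And>x \<tau>. complex_of_real x \<in> ball (of_real z0) \<rho> \<Longrightarrow> f (of_real x) = of_real \<tau> \<Longrightarrow>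
      deriv f (of_real x) \<in> \<real> \<Longrightarrow> Re (deriv f (of_real x)) < 0 \<Longrightarrow> \<alpha> \<tau> = Some (of_real x)"
    and Im_nonneg: "\<And>x. \<bar>x - z0\<bar> < \<rho> \<Longrightarrow> Im (f (of_real x)) \<ge> 0"
begin

abbreviation c :: complex where "c \<equiv> g (of_real z0)"

lemma f_\<psi>: "\<zeta> \<in> ball 0 \<delta> \<Longrightarrow> f (\<psi> \<zeta>) = of_real \<tau>0 + \<zeta> ^ n"
  using power[OF \<psi>_in] \<psi>_eq by (simp add: diff_eq_eq)

lemma f_deriv: "w \<in> ball (of_real z0) \<rho> \<Longrightarrow> (f has_field_derivative deriv f w) (at w)"
  by (rule holomorphic_derivI[OF hol_f open_ball])

lemma deriv_f:
  assumes w: "w \<in> ball (of_real z0) \<rho>"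
  shows "deriv f w = of_nat n * ((w - of_real z0) * g w) ^ (n - 1) * (g w + (w - of_real z0) * deriv g w)"
proof (rule DERIV_imp_deriv)
  have "(g has_field_derivative deriv g w) (at w)" by (rule holomorphic_derivI[OF hol_g open_ball w])
  hence "((\<lambda>w. of_real \<tau>0 + ((w - of_real z0) * g w) ^ n) has_field_derivative
     of_nat n * ((w - of_real z0) * g w) ^ (n - 1) * (g w + (w - of_real z0) * deriv g w)) (at w)"
    by (auto intro!: derivative_eq_intros simp: algebra_simps)
  thus "(f has_field_derivative of_nat n * ((w - of_real z0) * g w) ^ (n - 1) * (g w + (w - of_real z0) * deriv g w)) (at w)"
    by (rule has_field_derivative_transform_within_open[OF _ open_ball w]) (simp add: power[symmetric])
qed

lemma solution_direction:
  assumes \<omega>: "\<omega> \<noteq> 0"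
  shows "((\<lambda>s. (\<psi> (of_real s * \<omega>) - of_real z0) / of_real s) \<longlongrightarrow> \<omega> / c) (at_right 0)"
proof -
  have d: "((\<lambda>\<zeta>. (\<psi> \<zeta> - of_real z0) / \<zeta>) \<longlongrightarrow> 1 / c) (at 0)"
    using \<psi>_deriv unfolding has_field_derivative_iff \<psi>0 by simp
  have "((\<lambda>s. of_real s * \<omega>) \<longlongrightarrow> of_real 0 * \<omega>) (at_right 0)" by (intro tendsto_intros)
  moreover have "eventually (\<lambda>s. of_real s * \<omega> \<noteq> 0) (at_right 0)"
    using eventually_at_right_less[of "0::real"] by eventually_elim (use \<omega> in simp)
  ultimately have "filterlim (\<lambda>s. of_real s * \<omega>) (at 0) (at_right 0)"
    unfolding filterlim_at by simp
  from tendsto_mult[OF filterlim_compose[OF d this] tendsto_const[of \<omega>]]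
  have "((\<lambda>s. (\<psi> (of_real s * \<omega>) - of_real z0) / (of_real s * \<omega>) * \<omega>) \<longlongrightarrow> \<omega> / c) (at_right 0)" by simp
  moreover have "(\<psi> (of_real s * \<omega>) - of_real z0) / (of_real s * \<omega>) * \<omega> = (\<psi> (of_real s * \<omega>) - of_real z0) / of_real s" for s
    using \<omega> by simp
  ultimately show ?thesis by (simp only:)
qed

lemma eventually_in_ball:
  fixes w :: "real \<Rightarrow> complex"
  assumes "((\<lambda>s. (w s - of_real z0) / of_real s) \<longlongrightarrow> e) (at_right 0)"
  shows "(w \<longlongrightarrow> of_real z0) (at_right 0)" "eventually (\<lambda>s. w s \<in> ball (of_real z0) \<rho>) (at_right 0)"
proof -
  have "((\<lambda>s. (w s - of_real z0) / of_real s * of_real s + of_real z0) \<longlongrightarrow> e * of_real 0 + of_real z0) (at_right 0)"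
    by (intro tendsto_intros assms)
  moreover have "eventually (\<lambda>s. (w s - of_real z0) / of_real s * of_real s + of_real z0 = w s) (at_right 0)"
    using eventually_at_right_less[of "0::real"] by eventually_elim simp
  ultimately show lim: "(w \<longlongrightarrow> of_real z0) (at_right 0)" by (simp add: tendsto_cong)
  show "eventually (\<lambda>s. w s \<in> ball (of_real z0) \<rho>) (at_right 0)"
    using topological_tendstoD[OF lim open_ball] \<rho> by simp
qed

text \<open>
  In the direction \<open>e\<close> the derivative of \<open>f\<close> is \<open>s ^ (n - 1) * n * (e * c) ^ (n - 1) * c\<close> to leading
  order. The points \<open>w s\<close> need not be solutions: the lemma is also used for points
  between a solution and the real axis.
\<close>

lemma eventually_deriv_negative:
  assumes w: "((\<lambda>s. (w s - of_real z0) / of_real s) \<longlongrightarrow> e) (at_right 0)"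
    and neg: "Re (of_nat n * (e * c) ^ (n - 1) * c) < 0"
  shows "eventually (\<lambda>s. Re (deriv f (w s)) < 0) (at_right 0)"
proof -
  have z0: "of_real z0 \<in> ball (of_real z0 :: complex) \<rho>" using \<rho> by simp
  note lim = eventually_in_ball[OF w]
  have "isCont g (of_real z0)"
    using holomorphic_on_imp_continuous_on[OF hol_g] z0 by (simp add: continuous_on_eq_continuous_at)
  hence g: "((\<lambda>s. g (w s)) \<longlongrightarrow> c) (at_right 0)" using lim(1) by (rule isCont_tendsto_compose)
  have "isCont (deriv g) (of_real z0)"
    using holomorphic_on_imp_continuous_on[OF holomorphic_deriv[OF hol_g open_ball]] z0 by (simp add: continuous_on_eq_continuous_at)
  hence dg: "((\<lambda>s. deriv g (w s)) \<longlongrightarrow> deriv g (of_real z0)) (at_right 0)" using lim(1) by (rule isCont_tendsto_compose)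
  have "((\<lambda>s. Re (of_nat n * ((w s - of_real z0) / of_real s * g (w s)) ^ (n - 1) * (g (w s) + (w s - of_real z0) * deriv g (w s)))) \<longlongrightarrow>
     Re (of_nat n * (e * c) ^ (n - 1) * (c + (of_real z0 - of_real z0) * deriv g (of_real z0)))) (at_right 0)"
    by (intro tendsto_intros w g dg lim(1))
  hence "eventually (\<lambda>s. Re (of_nat n * ((w s - of_real z0) / of_real s * g (w s)) ^ (n - 1) * (g (w s) + (w s - of_real z0) * deriv g (w s))) < 0) (at_right 0)"
    by (rule order_tendstoD(2)) (use neg in simp)
  thus ?thesis using lim(2) eventually_at_right_less[of "0::real"]
  proof eventually_elim
    case (elim s)
    define X where "X = of_nat n * ((w s - of_real z0) / of_real s * g (w s)) ^ (n - 1) * (g (w s) + (w s - of_real z0) * deriv g (w s))"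
    have "(w s - of_real z0) * g (w s) = of_real s * ((w s - of_real z0) / of_real s * g (w s))"
      using elim(3) by simp
    hence "deriv f (w s) = of_nat n * (of_real s * ((w s - of_real z0) / of_real s * g (w s))) ^ (n - 1) * (g (w s) + (w s - of_real z0) * deriv g (w s))"
      unfolding deriv_f[OF elim(2)] by (simp only:)
    also have "\<dots> = of_real (s ^ (n - 1)) * X"
      unfolding X_def power_mult_distrib[of "of_real s"] of_real_power by (simp only: mult_ac)
    finally have "Re (deriv f (w s)) = s ^ (n - 1) * Re X" by simp
    moreover have "Re X < 0" unfolding X_def by (rule elim(1))
    ultimately show ?case using elim(3) by (simp add: mult_pos_neg)
  qed
qed

text \<open>
  The derivative of \<open>Im f\<close> in the upward direction is \<open>Im (\<i> * f') = Re f'\<close>.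
\<close>

lemma vertical_mean_value:
  assumes z: "z \<in> ball (of_real z0) \<rho>"
  obtains \<xi> where "0 < \<xi>" "\<xi> < 1"
    "Im (f z) - Im (f (of_real (Re z))) = Im z * Re (deriv f (of_real (Re z) + \<i> * of_real (\<xi> * Im z)))"
proof -
  define p where "p t = of_real (Re z) + \<i> * of_real (t * Im z)" for t
  have p: "p t \<in> ball (of_real z0) \<rho>" if "0 \<le> t" "t \<le> 1" for t
  proof -
    have "\<bar>t * Im z\<bar> \<le> \<bar>Im z\<bar>" using that by (simp add: abs_mult mult_left_le_one_le)
    hence "(t * Im z)\<^sup>2 \<le> (Im z)\<^sup>2" by (simp add: abs_le_square_iff)
    hence "cmod (of_real z0 - p t) \<le> cmod (of_real z0 - z)"
      unfolding cmod_def p_def by simp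
    thus ?thesis using z by (simp add: dist_norm)
  qed
  have "\<exists>\<xi>. 0 < \<xi> \<and> \<xi> < 1 \<and> Im (f (p 1)) - Im (f (p 0)) = (1 - 0) * (Im z * Re (deriv f (p \<xi>)))"
  proof (rule MVT2)
    fix t :: real assume t: "0 \<le> t" "t \<le> 1"
    have dp: "(p has_vector_derivative \<i> * of_real (Im z)) (at t)"
      unfolding p_def by (auto intro!: derivative_eq_intros simp: has_vector_derivative_def scaleR_conv_of_real)
    have "((f \<circ> p) has_vector_derivative (\<i> * of_real (Im z)) * deriv f (p t)) (at t)"
      by (rule field_vector_diff_chain_at[OF dp f_deriv[OF p[OF t]]])
    hence "((\<lambda>t. Im (f (p t))) has_vector_derivative Im ((\<i> * of_real (Im z)) * deriv f (p t))) (at t)"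
      unfolding o_def by (rule bounded_linear.has_vector_derivative[OF bounded_linear_Im])
    thus "((\<lambda>t. Im (f (p t))) has_real_derivative Im z * Re (deriv f (p t))) (at t)"
      by (simp add: has_real_derivative_iff_has_vector_derivative)
  qed simp
  then obtain \<xi> where \<xi>: "0 < \<xi>" "\<xi> < 1" "Im (f (p 1)) - Im (f (p 0)) = Im z * Re (deriv f (p \<xi>))" by auto
  have "p 1 = z" "p 0 = of_real (Re z)" by (simp_all add: p_def complex_eq_iff)
  with \<xi> show ?thesis using that[of \<xi>] by (simp add: p_def)
qed

text \<open>
  The nonnegative function \<open>Im f\<close> on the real axis has a minimum at \<open>x\<close>.
\<close>

lemma Im_deriv_zero_at_real_point:
  assumes x: "of_real x \<in> ball (of_real z0 :: complex) \<rho>" and real: "Im (f (of_real x)) = 0"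
  shows "Im (deriv f (of_real x)) = 0"
proof -
  have near: "\<bar>x - z0\<bar> < \<rho>" using x by (simp add: dist_norm abs_minus_commute flip: of_real_diff)
  have dp: "((\<lambda>t. of_real t :: complex) has_vector_derivative 1) (at x)"
    by (auto intro!: derivative_eq_intros simp: has_vector_derivative_def scaleR_conv_of_real)
  have "((f \<circ> of_real) has_vector_derivative 1 * deriv f (of_real x)) (at x)"
    by (rule field_vector_diff_chain_at[OF dp f_deriv[OF x]])
  hence "((\<lambda>t. Im (f (of_real t))) has_vector_derivative Im (1 * deriv f (of_real x))) (at x)"
    unfolding o_def by (rule bounded_linear.has_vector_derivative[OF bounded_linear_Im])
  hence d: "((\<lambda>t. Im (f (of_real t))) has_real_derivative Im (deriv f (of_real x))) (at x)"
    by (simp add: has_real_derivative_iff_has_vector_derivative)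
  have "\<rho> - \<bar>x - z0\<bar> > 0" using near by simp
  moreover have "\<forall>y. \<bar>x - y\<bar> < \<rho> - \<bar>x - z0\<bar> \<longrightarrow> Im (f (of_real x)) \<le> Im (f (of_real y))"
    using Im_nonneg real by (auto simp: abs_if split: if_splits)
  ultimately show ?thesis by (rule DERIV_local_min[OF d])
qed

text \<open>
  The unit vector \<open>\<omega>\<close> for which the arc \<open>\<psi> (s * \<omega>)\<close> leaves \<open>z0\<close> in the direction \<open>cis \<theta>\<close>; the arcs
  of interest are those with \<open>\<omega> ^ n = \<plusminus>1\<close>.
\<close>

definition branch_root :: "real \<Rightarrow> complex" where
  "branch_root \<theta> = c * cis \<theta> / of_real (cmod c)"

lemma branch_root_props:
  shows "cmod (branch_root \<theta>) = 1" "branch_root \<theta> / c = cis \<theta> / of_real (cmod c)"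
  using g0 by (simp_all add: branch_root_def norm_mult norm_divide)

lemma branch_root_power:
  assumes "c ^ n * cis (of_nat n * \<theta>) = of_real (\<sigma> * cmod c ^ n)"
  shows "branch_root \<theta> ^ n = of_real \<sigma>"
proof -
  have "branch_root \<theta> ^ n = (c ^ n * cis \<theta> ^ n) / of_real (cmod c ^ n)"
    unfolding branch_root_def by (simp add: power_mult_distrib power_divide)
  also have "cis \<theta> ^ n = cis (of_nat n * \<theta>)" by (rule Complex.DeMoivre)
  finally show ?thesis unfolding assms using g0 by simp
qed

text \<open>
  This treats arcs tangent to the real axis. The function \<open>Im f\<close> is zero at \<open>z s\<close>, nonnegative at
  the point of the real axis vertically above or below \<open>z s\<close>, and decreases upwards on the
  segment between them; so \<open>z s\<close> does not lie below the axis.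
\<close>

lemma branch_eventually_upper_and_negative:
  fixes z :: "real \<Rightarrow> complex"
  assumes lim: "((\<lambda>s. (z s - of_real z0) / of_real s) \<longlongrightarrow> of_real e) (at_right 0)"
    and neg: "Re (of_nat n * (of_real e * c) ^ (n - 1) * c) < 0"
    and real: "eventually (\<lambda>s. Im (f (z s)) = 0) (at_right 0)"
  shows "eventually (\<lambda>s. Im (z s) \<ge> 0 \<and> Re (deriv f (z s)) < 0) (at_right 0)"
proof -
  \<comment> \<open>The intermediate points given by the mean value theorem form a path \<open>w\<close> with the same direction as \<open>z\<close>.\<close>
  have "\<forall>s. \<exists>\<xi>. 0 < \<xi> \<and> \<xi> < 1 \<and> (z s \<in> ball (of_real z0) \<rho> \<longrightarrow>
      Im (f (z s)) - Im (f (of_real (Re (z s)))) = Im (z s) * Re (deriv f (of_real (Re (z s)) + \<i> * of_real (\<xi> * Im (z s)))))"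
  proof
    fix s
    show "\<exists>\<xi>. 0 < \<xi> \<and> \<xi> < 1 \<and> (z s \<in> ball (of_real z0) \<rho> \<longrightarrow>
      Im (f (z s)) - Im (f (of_real (Re (z s)))) = Im (z s) * Re (deriv f (of_real (Re (z s)) + \<i> * of_real (\<xi> * Im (z s)))))"
    proof (cases "z s \<in> ball (of_real z0) \<rho>")
      case True
      obtain \<xi> where "0 < \<xi>" "\<xi> < 1"
        "Im (f (z s)) - Im (f (of_real (Re (z s)))) = Im (z s) * Re (deriv f (of_real (Re (z s)) + \<i> * of_real (\<xi> * Im (z s))))"
        by (rule vertical_mean_value[OF True])
      thus ?thesis by (intro exI[of _ \<xi>] conjI impI)
    next
      case False
      thus ?thesis by (intro exI[of _ "1/2"]) simp
    qed
  qed
  from choice[OF this] obtain \<xi> where \<xi>: "\<forall>s. 0 < \<xi> s \<and> \<xi> s < 1 \<and> (z s \<in> ball (of_real z0) \<rho> \<longrightarrow>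
      Im (f (z s)) - Im (f (of_real (Re (z s)))) = Im (z s) * Re (deriv f (of_real (Re (z s)) + \<i> * of_real (\<xi> s * Im (z s)))))"
    by (elim exE)
  define w where "w s = of_real (Re (z s)) + \<i> * of_real (\<xi> s * Im (z s))" for s
  define q where "q s = (z s - of_real z0) / of_real s" for s
  have Re_q: "((\<lambda>s. Re (q s)) \<longlongrightarrow> e) (at_right 0)" and Im_q: "((\<lambda>s. Im (q s)) \<longlongrightarrow> 0) (at_right 0)"
    using tendsto_Re[OF lim] tendsto_Im[OF lim] unfolding q_def by simp_all
  have "((\<lambda>s. \<xi> s * Im (q s)) \<longlongrightarrow> 0) (at_right 0)"
  proof (rule Lim_null_comparison[OF _ tendsto_rabs_zero[OF Im_q]])
    have "norm (\<xi> s * Im (q s)) \<le> \<bar>Im (q s)\<bar>" for s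
      using \<xi>[rule_format, of s] by (simp add: abs_mult mult_left_le_one_le)
    thus "eventually (\<lambda>s. norm (\<xi> s * Im (q s)) \<le> \<bar>Im (q s)\<bar>) (at_right 0)" by simp
  qed
  hence "((\<lambda>s. of_real (Re (q s)) + \<i> * of_real (\<xi> s * Im (q s))) \<longlongrightarrow> of_real e + \<i> * of_real 0) (at_right 0)"
    by (intro tendsto_intros Re_q)
  moreover have "of_real (Re (q s)) + \<i> * of_real (\<xi> s * Im (q s)) = (w s - of_real z0) / of_real s" for s
    by (simp add: complex_eq_iff w_def q_def)
  ultimately have "((\<lambda>s. (w s - of_real z0) / of_real s) \<longlongrightarrow> of_real e) (at_right 0)" by simp
  from eventually_deriv_negative[OF this neg] eventually_deriv_negative[OF lim neg] eventually_in_ball(2)[OF lim] real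
  show ?thesis
  proof eventually_elim
    case (elim s)
    have "\<bar>Re (z s) - z0\<bar> \<le> cmod (z s - of_real z0)"
      using abs_Re_le_cmod[of "z s - of_real z0"] by simp
    also have "\<dots> < \<rho>" using elim(3) by (simp add: dist_norm norm_minus_commute)
    finally have "Im (f (of_real (Re (z s)))) \<ge> 0" by (rule Im_nonneg)
    moreover have "Im (f (z s)) - Im (f (of_real (Re (z s)))) = Im (z s) * Re (deriv f (w s))"
      using \<xi>[rule_format, of s] elim(3) unfolding w_def by simp
    ultimately have "Im (z s) * Re (deriv f (w s)) \<le> 0" using elim(4) by simp
    hence "Im (z s) \<ge> 0" using elim(1) by (simp add: mult_le_0_iff)
    thus ?case using elim(2) by simp
  qed
qed

text \<open>
  The hypothesis on \<open>\<theta>\<close> says that \<open>s \<mapsto> \<psi> (s * \<omega>)\<close> solves \<open>f w = \<tau>0 + \<sigma> * s ^ n\<close>. An arc that starts along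
  the real axis is the generalized zero only if \<open>f\<close> decreases along the axis there: \<open>f\<close> moves
  away from \<open>\<tau>0\<close> with sign \<open>\<sigma>\<close>, so \<open>\<sigma> = -1\<close> to the right of \<open>z0\<close> and \<open>\<sigma> = 1\<close> to the left of it.
\<close>

lemma branch_is_gznt:
  assumes \<sigma>: "\<sigma> = 1 \<or> \<sigma> = -1" and \<theta>: "0 \<le> \<theta>" "\<theta> \<le> pi"
    and dir: "c ^ n * cis (of_nat n * \<theta>) = of_real (\<sigma> * cmod c ^ n)"
    and edge: "\<theta> = 0 \<Longrightarrow> \<sigma> = -1" "\<theta> = pi \<Longrightarrow> \<sigma> = 1"
  shows "eventually (\<lambda>s. \<alpha> (\<tau>0 + \<sigma> * s ^ n) = Some (\<psi> (of_real s * branch_root \<theta>)) \<and>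
           Im (\<psi> (of_real s * branch_root \<theta>)) \<ge> 0) (at_right 0)"
proof -
  define \<omega> where "\<omega> = branch_root \<theta>"
  define z where "z s = \<psi> (of_real s * \<omega>)" for s
  have \<omega>: "cmod \<omega> = 1" "\<omega> / c = cis \<theta> / of_real (cmod c)" "\<omega> ^ n = of_real \<sigma>"
    unfolding \<omega>_def by (rule branch_root_props branch_root_power[OF dir])+
  have \<omega>0: "\<omega> \<noteq> 0" using \<omega>(1) by auto
  have lim: "((\<lambda>s. (z s - of_real z0) / of_real s) \<longlongrightarrow> cis \<theta> / of_real (cmod c)) (at_right 0)"
    using solution_direction[OF \<omega>0] unfolding \<omega>(2) z_def .
  have pos: "eventually (\<lambda>s::real. s > 0) (at_right 0)" by (rule eventually_at_right_less)
  have "eventually (\<lambda>s. s < \<delta>) (at_right 0)"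
    using order_tendstoD(2)[OF tendsto_ident_at \<delta>] .
  with pos have val: "eventually (\<lambda>s. f (z s) = of_real (\<tau>0 + \<sigma> * s ^ n)) (at_right 0)"
  proof eventually_elim
    case (elim s)
    have "of_real s * \<omega> \<in> ball 0 \<delta>" using elim \<omega>(1) by (simp add: norm_mult)
    from f_\<psi>[OF this] show ?case by (simp add: z_def power_mult_distrib \<omega>(3))
  qed
  note inb = eventually_in_ball(2)[OF lim]
  have "eventually (\<lambda>s. \<alpha> (\<tau>0 + \<sigma> * s ^ n) = Some (z s) \<and> Im (z s) \<ge> 0) (at_right 0)"
  proof (cases "\<theta> = 0 \<or> \<theta> = pi")
    case False
    hence "sin \<theta> > 0" using \<theta> by (intro sin_gt_zero) auto
    hence "Im (cis \<theta> / of_real (cmod c)) > 0" using g0 by simp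
    from order_tendstoD(1)[OF tendsto_Im[OF lim] this] val inb pos
    show ?thesis
    proof eventually_elim
      case (elim s)
      have "Im (z s) > 0" using elim(1,4) by (simp add: zero_less_divide_iff)
      thus ?case using interior[OF elim(3) _ elim(2)] by simp
    qed
  next
    case True
    define e where "e = - \<sigma> / cmod c"
    have cis: "cis \<theta> = of_real (- \<sigma>)" using True edge by auto
    hence lim': "((\<lambda>s. (z s - of_real z0) / of_real s) \<longlongrightarrow> of_real e) (at_right 0)"
      using lim by (simp add: e_def)
    have ec: "of_real e * c = \<omega>" using \<omega>(2) g0 unfolding cis e_def by (simp add: field_simps)
    have e0: "complex_of_real e \<noteq> 0" using \<sigma> g0 by (auto simp: e_def)
    have "e * (- cmod c) = \<sigma>" using g0 by (simp add: e_def)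
    hence e\<sigma>: "complex_of_real \<sigma> = of_real e * of_real (- cmod c)" by (simp flip: of_real_mult)
    have "of_real e * (\<omega> ^ (n - 1) * c) = \<omega> ^ (n - 1) * (of_real e * c)" by (simp only: mult_ac)
    also have "\<dots> = of_real \<sigma>" by (simp only: ec power_minus_mult[OF n] \<omega>(3))
    finally have "of_real e * (\<omega> ^ (n - 1) * c) = of_real e * of_real (- cmod c)" unfolding e\<sigma> .
    hence "\<omega> ^ (n - 1) * c = of_real (- cmod c)" by (simp only: mult_left_cancel[OF e0])
    hence "of_nat n * (of_real e * c) ^ (n - 1) * c = of_real (- (of_nat n * cmod c))"
      unfolding ec by (simp add: mult.assoc)
    hence neg: "Re (of_nat n * (of_real e * c) ^ (n - 1) * c) < 0" using n g0 by simp
    have "eventually (\<lambda>s. Im (f (z s)) = 0) (at_right 0)" using val by eventually_elim simp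
    from branch_eventually_upper_and_negative[OF lim' neg this] val inb
    show ?thesis
    proof eventually_elim
      case (elim s)
      show ?case
      proof (cases "Im (z s) > 0")
        case True
        thus ?thesis using interior[OF elim(3) _ elim(2)] by simp
      next
        case False
        define x where "x = Re (z s)"
        have zs: "z s = of_real x" using False elim(1) by (simp add: x_def complex_eq_iff)
        have "Im (deriv f (of_real x)) = 0"
          using Im_deriv_zero_at_real_point[of x] elim(2,3) unfolding zs by simp
        hence "deriv f (of_real x) \<in> \<real>" by (simp add: complex_is_Real_iff)
        from boundary[OF elim(3)[unfolded zs] elim(2)[unfolded zs] this] elim(1)
        show ?thesis unfolding zs by simp
      qed
    qed
  qed
  thus ?thesis unfolding z_def \<omega>_def .
qed

text \<open>
  The arc is reparametrized by \<open>s = (\<sigma> * (\<tau> - \<tau>0)) powr (1 / n)\<close>. The principal power is holomorphic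
  in the half-plane to the relevant side of \<open>\<tau>0\<close>, which gives the holomorphic continuation of \<open>\<alpha>\<close>.
\<close>

lemma branch_interval:
  assumes \<sigma>: "\<sigma> = 1 \<or> \<sigma> = -1" and \<theta>: "0 \<le> \<theta>" "\<theta> \<le> pi"
    and dir: "c ^ n * cis (of_nat n * \<theta>) = of_real (\<sigma> * cmod c ^ n)"
    and edge: "\<theta> = 0 \<Longrightarrow> \<sigma> = -1" "\<theta> = pi \<Longrightarrow> \<sigma> = 1"
  shows "\<exists>\<epsilon>>0. holomorphic_on_interval \<alpha> {\<tau>. 0 < \<sigma> * (\<tau> - \<tau>0) \<and> \<sigma> * (\<tau> - \<tau>0) < \<epsilon>}"
    and "((\<lambda>x. arg_from \<alpha> z0 (\<tau>0 + \<sigma> * x)) \<longlongrightarrow> \<theta>) (at_right 0)"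
proof -
  define \<omega> where "\<omega> = branch_root \<theta>"
  have \<omega>: "cmod \<omega> = 1" "\<omega> / c = cis \<theta> / of_real (cmod c)"
    unfolding \<omega>_def by (rule branch_root_props)+
  have \<omega>0: "\<omega> \<noteq> 0" using \<omega>(1) by auto
  have ss: "\<sigma> * (\<sigma> * x) = x" for x using \<sigma> by auto
  have gz: "eventually (\<lambda>s. \<alpha> (\<tau>0 + \<sigma> * s ^ n) = Some (\<psi> (of_real s * \<omega>)) \<and> Im (\<psi> (of_real s * \<omega>)) \<ge> 0) (at_right 0)"
    unfolding \<omega>_def by (rule branch_is_gznt[OF \<sigma> \<theta> dir]) (erule edge)+
  obtain b where b: "b > 0" "\<And>s. 0 < s \<Longrightarrow> s < b \<Longrightarrow> \<alpha> (\<tau>0 + \<sigma> * s ^ n) = Some (\<psi> (of_real s * \<omega>))"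
    using gz unfolding eventually_at_right_field by blast
  define \<epsilon> where "\<epsilon> = min b \<delta> ^ n"
  have \<epsilon>: "\<epsilon> > 0" using b(1) \<delta> by (simp add: \<epsilon>_def)
  have root_less: "root n x < min b \<delta>" if "x < \<epsilon>" for x
  proof -
    have "root n x < root n \<epsilon>" using that n by simp
    also have "root n \<epsilon> = min b \<delta>" unfolding \<epsilon>_def using n b(1) \<delta> by (intro real_root_power_cancel) auto
    finally show ?thesis .
  qed
  define P where "P t = (of_real \<sigma> * (t - of_real \<tau>0)) powr of_real (1 / of_nat n) * \<omega>" for t :: complex
  define S where "S = {t. Re (of_real \<sigma> * (t - of_real \<tau>0)) > 0}"
  have openS: "open S" unfolding S_def by (intro open_Collect_less continuous_intros)
  have holP: "P holomorphic_on S"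
    unfolding P_def S_def by (intro holomorphic_intros) (auto simp: complex_nonpos_Reals_iff)
  define U where "U = S \<inter> P -` ball 0 \<delta>"
  have openU: "open U" unfolding U_def
    by (rule continuous_open_preimage[OF holomorphic_on_imp_continuous_on[OF holP] openS open_ball])
  have "P holomorphic_on U" using holP by (rule holomorphic_on_subset) (simp add: U_def)
  moreover have "P ` U \<subseteq> ball 0 \<delta>" unfolding U_def by blast
  ultimately have "(\<psi> \<circ> P) holomorphic_on U"
    using holomorphic_on_compose_gen[OF _ hol_\<psi>] by blast
  moreover have "of_real \<tau> \<in> U \<and> \<alpha> \<tau> = Some ((\<psi> \<circ> P) (of_real \<tau>))"
    if \<tau>: "0 < \<sigma> * (\<tau> - \<tau>0)" "\<sigma> * (\<tau> - \<tau>0) < \<epsilon>" for \<tau>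
  proof -
    define s where "s = root n (\<sigma> * (\<tau> - \<tau>0))"
    have s: "0 < s" "s < b" "s < \<delta>" using root_less[OF \<tau>(2)] \<tau>(1) n by (simp_all add: s_def)
    have sn: "s ^ n = \<sigma> * (\<tau> - \<tau>0)" unfolding s_def using \<tau>(1) n by simp
    have "complex_of_real \<sigma> * (of_real \<tau> - of_real \<tau>0) = of_real (\<sigma> * (\<tau> - \<tau>0))" by simp
    hence "P (of_real \<tau>) = of_real ((\<sigma> * (\<tau> - \<tau>0)) powr (1 / of_nat n)) * \<omega>"
      unfolding P_def by (simp only: powr_of_real[OF less_imp_le[OF \<tau>(1)]])
    also have "(\<sigma> * (\<tau> - \<tau>0)) powr (1 / of_nat n) = s"
      unfolding s_def using root_powr_inverse[of n "\<sigma> * (\<tau> - \<tau>0)"] n \<tau>(1) by simp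
    finally have Ps: "P (of_real \<tau>) = of_real s * \<omega>" .
    have "of_real \<tau> \<in> U" unfolding U_def S_def using Ps s \<omega>(1) \<tau>(1) by (simp add: norm_mult)
    moreover have "\<tau>0 + \<sigma> * s ^ n = \<tau>" unfolding sn ss by simp
    hence "\<alpha> \<tau> = Some (\<psi> (of_real s * \<omega>))" using b(2)[OF s(1,2)] by simp
    ultimately show ?thesis using Ps by simp
  qed
  ultimately have "holomorphic_on_interval \<alpha> {\<tau>. 0 < \<sigma> * (\<tau> - \<tau>0) \<and> \<sigma> * (\<tau> - \<tau>0) < \<epsilon>}"
    unfolding holomorphic_on_interval_def using openU by (intro exI[of _ "\<psi> \<circ> P"] exI[of _ U]) auto
  thus "\<exists>\<epsilon>>0. holomorphic_on_interval \<alpha> {\<tau>. 0 < \<sigma> * (\<tau> - \<tau>0) \<and> \<sigma> * (\<tau> - \<tau>0) < \<epsilon>}"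
    using \<epsilon> by (intro exI[of _ \<epsilon>] conjI)
  have lim: "((\<lambda>s. (\<psi> (of_real s * \<omega>) - of_real z0) / of_real s) \<longlongrightarrow> cis \<theta> / of_real (cmod c)) (at_right 0)"
    using solution_direction[OF \<omega>0] unfolding \<omega>(2) .
  have "eventually (\<lambda>s. Im ((\<psi> (of_real s * \<omega>) - of_real z0) / of_real s) \<ge> 0) (at_right 0)"
    using gz eventually_at_right_less[of "0::real"] by eventually_elim simp
  hence "((\<lambda>s. Arg ((\<psi> (of_real s * \<omega>) - of_real z0) / of_real s)) \<longlongrightarrow> Arg (cis \<theta> / of_real (cmod c))) (at_right 0)"
    by (intro tendsto_Arg_closed_upper[OF lim]) (use g0 in auto)
  moreover have "\<theta> \<in> {-pi<..pi}" using \<theta> pi_gt_zero unfolding greaterThanAtMost_iff by linarith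
  hence "Arg (cis \<theta> / of_real (cmod c)) = \<theta>" using g0 by (simp add: Arg_cis)
  ultimately have A: "((\<lambda>s. Arg ((\<psi> (of_real s * \<omega>) - of_real z0) / of_real s)) \<longlongrightarrow> \<theta>) (at_right 0)" by simp
  have "eventually (\<lambda>s. Arg ((\<psi> (of_real s * \<omega>) - of_real z0) / of_real s) = arg_from \<alpha> z0 (\<tau>0 + \<sigma> * s ^ n)) (at_right 0)"
    using gz eventually_at_right_less[of "0::real"] by eventually_elim (simp add: arg_from_def)
  with A have B: "((\<lambda>s. arg_from \<alpha> z0 (\<tau>0 + \<sigma> * s ^ n)) \<longlongrightarrow> \<theta>) (at_right 0)" by (simp add: tendsto_cong)
  have "((\<lambda>x. root n x) \<longlongrightarrow> root n 0) (at_right 0)" by (intro tendsto_real_root tendsto_ident_at)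
  moreover have "eventually (\<lambda>x. root n x > 0) (at_right 0)"
    using eventually_at_right_less[of "0::real"] by eventually_elim (use n in simp)
  ultimately have "filterlim (root n) (at_right 0) (at_right 0)"
    unfolding filterlim_at by (auto elim: eventually_mono)
  from filterlim_compose[OF B this]
  have "((\<lambda>x. arg_from \<alpha> z0 (\<tau>0 + \<sigma> * root n x ^ n)) \<longlongrightarrow> \<theta>) (at_right 0)" .
  moreover have "eventually (\<lambda>x. arg_from \<alpha> z0 (\<tau>0 + \<sigma> * root n x ^ n) = arg_from \<alpha> z0 (\<tau>0 + \<sigma> * x)) (at_right 0)"
    using eventually_at_right_less[of "0::real"] by eventually_elim (use n in simp)
  ultimately show "((\<lambda>x. arg_from \<alpha> z0 (\<tau>0 + \<sigma> * x)) \<longlongrightarrow> \<theta>) (at_right 0)" by (simp add: tendsto_cong)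
qed

lemma branch_above:
  assumes \<theta>: "0 < \<theta>" "\<theta> \<le> pi" and dir: "c ^ n * cis (of_nat n * \<theta>) = of_real (cmod c ^ n)"
  shows "\<exists>\<epsilon>>0. holomorphic_on_interval \<alpha> {\<tau>0<..<\<tau>0 + \<epsilon>}" "(arg_from \<alpha> z0 \<longlongrightarrow> \<theta>) (at_right \<tau>0)"
proof -
  have *: "{\<tau>. 0 < 1 * (\<tau> - \<tau>0) \<and> 1 * (\<tau> - \<tau>0) < \<epsilon>} = {\<tau>0<..<\<tau>0 + \<epsilon>}" for \<epsilon> by auto
  have "c ^ n * cis (of_nat n * \<theta>) = of_real (1 * cmod c ^ n)" using dir by simp
  note br = branch_interval[of 1 \<theta>, OF _ _ \<theta>(2) this]
  show "\<exists>\<epsilon>>0. holomorphic_on_interval \<alpha> {\<tau>0<..<\<tau>0 + \<epsilon>}"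
    using br(1) \<theta>(1) unfolding * by simp
  have "((\<lambda>x. arg_from \<alpha> z0 (\<tau>0 + 1 * x)) \<longlongrightarrow> \<theta>) (at_right 0)" using br(2) \<theta>(1) by simp
  thus "(arg_from \<alpha> z0 \<longlongrightarrow> \<theta>) (at_right \<tau>0)"
    by (subst filterlim_at_right_to_0) (simp add: add.commute)
qed

lemma branch_below:
  assumes \<theta>: "0 \<le> \<theta>" "\<theta> < pi" and dir: "c ^ n * cis (of_nat n * \<theta>) = - of_real (cmod c ^ n)"
  shows "\<exists>\<epsilon>>0. holomorphic_on_interval \<alpha> {\<tau>0 - \<epsilon><..<\<tau>0}" "(arg_from \<alpha> z0 \<longlongrightarrow> \<theta>) (at_left \<tau>0)"
proof -
  have *: "{\<tau>. 0 < (-1) * (\<tau> - \<tau>0) \<and> (-1) * (\<tau> - \<tau>0) < \<epsilon>} = {\<tau>0 - \<epsilon><..<\<tau>0}" for \<epsilon> by auto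
  have "c ^ n * cis (of_nat n * \<theta>) = of_real ((-1) * cmod c ^ n)" using dir by simp
  note br = branch_interval[of "-1" \<theta>, OF _ \<theta>(1) _ this]
  show "\<exists>\<epsilon>>0. holomorphic_on_interval \<alpha> {\<tau>0 - \<epsilon><..<\<tau>0}"
    using br(1) \<theta>(2) unfolding * by simp
  have "((\<lambda>x. arg_from \<alpha> z0 (\<tau>0 + (-1) * x)) \<longlongrightarrow> \<theta>) (at_right 0)" using br(2) \<theta>(2) by simp
  thus "(arg_from \<alpha> z0 \<longlongrightarrow> \<theta>) (at_left \<tau>0)"
    by (subst filterlim_at_left_to_right, subst filterlim_at_right_to_0) simp
qed

text \<open>
  For \<open>n = 1\<close> the two arcs are the two halves of \<open>\<tau> \<mapsto> \<psi> (\<tau> - \<tau>0)\<close>, which is holomorphic at \<open>\<tau>0\<close> as well.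
\<close>

lemma simple_branch_holomorphic:
  assumes n1: "n = 1" and c: "c \<in> \<real>" "Re c < 0" and \<alpha>0: "\<alpha> \<tau>0 = Some (of_real z0)"
  shows "\<exists>\<epsilon>>0. holomorphic_on_interval \<alpha> {\<tau>0 - \<epsilon><..<\<tau>0 + \<epsilon>}"
proof -
  have cr: "c = of_real (- cmod c)" using c by (auto simp: complex_is_Real_iff cmod_def complex_eq_iff)
  hence mc: "- c = of_real (cmod c)" by (metis minus_minus of_real_minus)
  have cm: "complex_of_real (cmod c) \<noteq> 0" using g0 by simp
  have roots: "branch_root pi = 1" "branch_root 0 = -1"
  proof -
    have "c / of_real (cmod c) = -1" using cr cm by (metis divide_minus_left of_real_minus divide_self)
    thus "branch_root pi = 1" "branch_root 0 = -1" by (simp_all add: branch_root_def)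
  qed
  have "c ^ n * cis (of_nat n * pi) = of_real (1 * cmod c ^ n)" using mc by (simp add: n1)
  moreover have "c ^ n * cis (of_nat n * 0) = of_real ((-1) * cmod c ^ n)"
    unfolding n1 using cr by simp
  ultimately have up: "eventually (\<lambda>s. \<alpha> (\<tau>0 + 1 * s ^ n) = Some (\<psi> (of_real s * branch_root pi)) \<and> Im (\<psi> (of_real s * branch_root pi)) \<ge> 0) (at_right 0)"
    and down: "eventually (\<lambda>s. \<alpha> (\<tau>0 + (-1) * s ^ n) = Some (\<psi> (of_real s * branch_root 0)) \<and> Im (\<psi> (of_real s * branch_root 0)) \<ge> 0) (at_right 0)"
    using branch_is_gznt[of 1 pi] branch_is_gznt[of "-1" 0] by simp_all
  obtain b1 where b1: "b1 > 0" "\<And>s. 0 < s \<Longrightarrow> s < b1 \<Longrightarrow> \<alpha> (\<tau>0 + s) = Some (\<psi> (of_real s))"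
    using up unfolding eventually_at_right_field roots n1 by auto
  obtain b2 where b2: "b2 > 0" "\<And>s. 0 < s \<Longrightarrow> s < b2 \<Longrightarrow> \<alpha> (\<tau>0 - s) = Some (\<psi> (- of_real s))"
    using down unfolding eventually_at_right_field roots n1 by auto
  define \<epsilon> where "\<epsilon> = min \<delta> (min b1 b2)"
  have \<epsilon>: "\<epsilon> > 0" "\<epsilon> \<le> \<delta>" "\<epsilon> \<le> b1" "\<epsilon> \<le> b2" using \<delta> b1(1) b2(1) by (auto simp: \<epsilon>_def)
  have "(\<psi> \<circ> (\<lambda>t. t - of_real \<tau>0)) holomorphic_on ball (of_real \<tau>0) \<delta>"
    by (rule holomorphic_on_compose_gen[OF _ hol_\<psi>]) (auto intro!: holomorphic_intros simp: dist_norm norm_minus_commute)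
  moreover have "of_real \<tau> \<in> ball (complex_of_real \<tau>0) \<delta> \<and> \<alpha> \<tau> = Some ((\<psi> \<circ> (\<lambda>t. t - of_real \<tau>0)) (of_real \<tau>))"
    if "\<tau> \<in> {\<tau>0 - \<epsilon><..<\<tau>0 + \<epsilon>}" for \<tau>
  proof
    have "\<bar>\<tau>0 - \<tau>\<bar> < \<delta>" using that \<epsilon>(2) by auto
    thus "of_real \<tau> \<in> ball (complex_of_real \<tau>0) \<delta>" by (simp add: dist_norm flip: of_real_diff)
    consider "\<tau> = \<tau>0" | "\<tau> > \<tau>0" | "\<tau> < \<tau>0" by linarith
    thus "\<alpha> \<tau> = Some ((\<psi> \<circ> (\<lambda>t. t - of_real \<tau>0)) (of_real \<tau>))"
    proof cases
      case 1
      thus ?thesis using \<alpha>0 \<psi>0 by simp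
    next
      case 2
      thus ?thesis using b1(2)[of "\<tau> - \<tau>0"] that \<epsilon>(3) by simp
    next
      case 3
      thus ?thesis using b2(2)[of "\<tau>0 - \<tau>"] that \<epsilon>(4) by simp
    qed
  qed
  ultimately have "holomorphic_on_interval \<alpha> {\<tau>0 - \<epsilon><..<\<tau>0 + \<epsilon>}"
    unfolding holomorphic_on_interval_def
    by (intro exI[of _ "\<psi> \<circ> (\<lambda>t. t - of_real \<tau>0)"] exI[of _ "ball (of_real \<tau>0) \<delta>"]) auto
  thus ?thesis using \<epsilon>(1) by (intro exI[of _ \<epsilon>] conjI)
qed

end

section \<open>Local behaviour of the generalized zero\<close>

theorem theorem4p2:
  fixes Q Qt :: "complex \<Rightarrow> complex"
    and \<Omega> :: "complex set"
    and z0 \<tau>0 :: real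
    and \<alpha> :: "real \<Rightarrow> complex option"
  assumes "Q \<in> N1"
    and "open \<Omega>" and "simply_connected \<Omega>" and "of_real z0 \<in> \<Omega>"
    and "Qt holomorphic_on \<Omega>" and "\<forall>z \<in> \<Omega> \<inter> \<complex>\<^sup>+. Qt z = Q z"
    and "\<forall>\<tau>. is_gznt (Q_transform Q \<tau>) (\<alpha> \<tau>)"
    and "\<alpha> \<tau>0 = Some (of_real z0)"
  shows
   "let d1 = deriv Qt (of_real z0);
        d2 = (deriv ^^ 2) Qt (of_real z0);
        d3 = (deriv ^^ 3) Qt (of_real z0);
        case1 = (d1 \<in> \<real> \<and> Re d1 < 0);
        case2 = (d1 = 0 \<and> d2 \<noteq> 0);
        case3 = (d1 = 0 \<and> d2 = 0 \<and> d3 \<noteq> 0)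
    in exactly_one case1 case2 case3 \<and>
       (case1 \<longrightarrow>
          (\<exists>\<epsilon>>0. holomorphic_on_interval \<alpha> {\<tau>0 - \<epsilon> <..< \<tau>0 + \<epsilon>}) \<and>
          (arg_from \<alpha> z0 \<longlongrightarrow> 0) (at_left \<tau>0) \<and>
          (arg_from \<alpha> z0 \<longlongrightarrow> pi) (at_right \<tau>0)) \<and>
       (case2 \<longrightarrow>
          (\<exists>\<epsilon>1>0. \<exists>\<epsilon>2>0. holomorphic_on_interval \<alpha> {\<tau>0 - \<epsilon>1 <..< \<tau>0} \<and>
                            holomorphic_on_interval \<alpha> {\<tau>0 <..< \<tau>0 + \<epsilon>2}) \<and>
          (arg_from \<alpha> z0 \<longlongrightarrow> (2 * pi - Arg d2) / 2) (at_right \<tau>0) \<and>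
          (arg_from \<alpha> z0 \<longlongrightarrow> (pi - Arg d2) / 2) (at_left \<tau>0)) \<and>
       (case3 \<longrightarrow>
          (\<exists>\<epsilon>1>0. \<exists>\<epsilon>2>0. holomorphic_on_interval \<alpha> {\<tau>0 - \<epsilon>1 <..< \<tau>0} \<and>
                            holomorphic_on_interval \<alpha> {\<tau>0 <..< \<tau>0 + \<epsilon>2}) \<and>
          (arg_from \<alpha> z0 \<longlongrightarrow> pi / 3) (at_left \<tau>0) \<and>
          (arg_from \<alpha> z0 \<longlongrightarrow> 2 * pi / 3) (at_right \<tau>0))"
proof -
  let ?z = "complex_of_real z0"
  obtain r where r: "r > 0" "ball ?z r \<subseteq> \<Omega>"
    using assms(2,4) by (meson open_contains_ball)
  interpret H: holomorphic_boundary_extension Q Qt \<alpha> z0 r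
  proof
    show "Qt holomorphic_on ball ?z r" using assms(5) r(2) by (rule holomorphic_on_subset)
    show "Qt z = Q z" if "z \<in> ball ?z r" "Im z > 0" for z
      using assms(6) r(2) that by (simp add: subset_iff)
  qed (use assms(1,7) r(1) in simp_all)
  obtain n g \<rho> where q0: "Qt ?z = of_real \<tau>0"
    and n: "n > 0" "\<forall>i. 0 < i \<and> i < n \<longrightarrow> (deriv ^^ i) Qt ?z = 0"
    and g: "\<rho> > 0" "ball ?z \<rho> \<subseteq> ball ?z r" "g holomorphic_on ball ?z \<rho>"
    "\<forall>w\<in>ball ?z \<rho>. Qt w - of_real \<tau>0 = ((w - ?z) * g w) ^ n" "g ?z \<noteq> 0"
    "(deriv ^^ n) Qt ?z = fact n * g ?z ^ n"
    and trichotomy: "n = 1 \<and> g ?z ^ n \<in> \<real> \<and> Re (g ?z ^ n) < 0 \<or> n = 2 \<and> Im (g ?z ^ n) \<ge> 0 \<or>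
     n = 3 \<and> g ?z ^ n \<in> \<real> \<and> Re (g ?z ^ n) > 0"
    by (rule H.order_at_gznt[OF assms(8)])
  have "Im (Qt ?z) = 0" using q0 by simp
  then obtain \<rho>' where \<rho>': "\<rho>' > 0" "\<rho>' \<le> r" "\<And>x. \<bar>x - z0\<bar> < \<rho>' \<Longrightarrow> Im (Qt (of_real x)) \<ge> 0"
    using H.Im_nonneg_on_reals by metis
  define R where "R = min \<rho> \<rho>'"
  have R: "R > 0" "ball ?z R \<subseteq> ball ?z \<rho>" "ball ?z R \<subseteq> ball ?z r"
    using g(1) \<rho>'(1,2) by (auto simp: R_def)
  have gR: "g holomorphic_on ball ?z R" using g(3) R(2) by (rule holomorphic_on_subset)
  obtain \<psi> \<delta> where \<psi>: "\<delta> > 0" "\<psi> holomorphic_on ball 0 \<delta>" "\<psi> 0 = ?z"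
    "\<forall>\<zeta>\<in>ball 0 \<delta>. \<psi> \<zeta> \<in> ball ?z R \<and> (\<psi> \<zeta> - ?z) * g (\<psi> \<zeta>) = \<zeta>"
    "(\<psi> has_field_derivative 1 / g ?z) (at 0)"
    by (rule local_inverse_of_linear_factor[OF R(1) gR g(5)])
  interpret B: solution_branches Qt g \<psi> \<alpha> z0 \<tau>0 R \<delta> n
  proof
    show "Qt holomorphic_on ball ?z R" using H.hol R(3) by (rule holomorphic_on_subset)
    show "Qt w - of_real \<tau>0 = ((w - ?z) * g w) ^ n" if "w \<in> ball ?z R" for w
      using g(4) R(2) that by blast
    show "\<alpha> \<tau> = Some z" if "z \<in> ball ?z R" "Im z > 0" "Qt z = of_real \<tau>" for z \<tau>
      using H.gznt_eq_interior_solution[of z \<tau>] that R(3) by blast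
    show "\<alpha> \<tau> = Some (of_real x)" if "complex_of_real x \<in> ball ?z R" "Qt (of_real x) = of_real \<tau>"
      "deriv Qt (of_real x) \<in> \<real>" "Re (deriv Qt (of_real x)) < 0" for x \<tau>
      using H.gznt_eq_boundary_solution[of x \<tau>] that R(3) by blast
    show "Im (Qt (of_real x)) \<ge> 0" if "\<bar>x - z0\<bar> < R" for x
      using \<rho>'(3) that by (simp add: R_def)
  qed (use R(1) n(1) gR g(5) \<psi> in simp_all)
  define d1 where "d1 = deriv Qt ?z"
  define d2 where "d2 = (deriv ^^ 2) Qt ?z"
  define d3 where "d3 = (deriv ^^ 3) Qt ?z"
  have lower: "d1 = 0" if "n > 1" using n(2)[rule_format, of 1] that by (simp add: d1_def)
  have lower2: "d2 = 0" if "n > 2" using n(2)[rule_format, of 2] that by (simp add: d2_def)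
  define c where "c = g ?z"
  have c0: "c \<noteq> 0" using g(5) by (simp add: c_def)
  define case1 where "case1 = (d1 \<in> \<real> \<and> Re d1 < 0)"
  define case2 where "case2 = (d1 = 0 \<and> d2 \<noteq> 0)"
  define case3 where "case3 = (d1 = 0 \<and> d2 = 0 \<and> d3 \<noteq> 0)"
  define concl1 where "concl1 = ((\<exists>\<epsilon>>0. holomorphic_on_interval \<alpha> {\<tau>0 - \<epsilon> <..< \<tau>0 + \<epsilon>}) \<and>
          (arg_from \<alpha> z0 \<longlongrightarrow> 0) (at_left \<tau>0) \<and> (arg_from \<alpha> z0 \<longlongrightarrow> pi) (at_right \<tau>0))"
  define concl where "concl \<theta>1 \<theta>2 = ((\<exists>\<epsilon>1>0. \<exists>\<epsilon>2>0. holomorphic_on_interval \<alpha> {\<tau>0 - \<epsilon>1 <..< \<tau>0} \<and>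
          holomorphic_on_interval \<alpha> {\<tau>0 <..< \<tau>0 + \<epsilon>2}) \<and>
          (arg_from \<alpha> z0 \<longlongrightarrow> \<theta>1) (at_left \<tau>0) \<and> (arg_from \<alpha> z0 \<longlongrightarrow> \<theta>2) (at_right \<tau>0))" for \<theta>1 \<theta>2
  \<comment> \<open>A direction \<open>\<theta>\<close> is admissible if the leading term \<open>(c * cis \<theta>) ^ n\<close> has the sign of \<open>\<tau> - \<tau>0\<close>.\<close>
  have branches: "concl \<theta>1 \<theta>2"
    if "0 \<le> \<theta>1" "\<theta>1 < pi" "c ^ n * cis (of_nat n * \<theta>1) = - of_real (cmod c ^ n)"
      and "0 < \<theta>2" "\<theta>2 \<le> pi" "c ^ n * cis (of_nat n * \<theta>2) = of_real (cmod c ^ n)" for \<theta>1 \<theta>2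
    unfolding concl_def
    using B.branch_below[folded c_def, OF that(1-3)] B.branch_above[folded c_def, OF that(4-6)] by blast
  have "exactly_one case1 case2 case3 \<and> (case1 \<longrightarrow> concl1) \<and>
      (case2 \<longrightarrow> concl ((pi - Arg d2) / 2) ((2 * pi - Arg d2) / 2)) \<and>
      (case3 \<longrightarrow> concl (pi / 3) (2 * pi / 3))"
  proof -
    consider (1) "n = 1" "c ^ n \<in> \<real>" "Re (c ^ n) < 0" | (2) "n = 2" "Im (c ^ n) \<ge> 0"
      | (3) "n = 3" "c ^ n \<in> \<real>" "Re (c ^ n) > 0"
      using trichotomy unfolding c_def by blast
    thus ?thesis
    proof cases
      case 1
      have d1: "d1 = c" using g(6) by (simp add: 1(1) d1_def c_def)
      have cs: "case1" "\<not> case2" "\<not> case3" using 1 c0 d1 by (simp_all add: case1_def case2_def case3_def)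
      have cm: "c = - of_real (cmod c)"
        using 1 by (auto simp: complex_is_Real_iff cmod_def complex_eq_iff)
      hence cm': "- c = of_real (cmod c)" by (metis minus_minus)
      have "concl 0 pi"
        by (rule branches) (use cm cm' in \<open>simp_all add: 1(1)\<close>)
      moreover have "\<exists>\<epsilon>>0. holomorphic_on_interval \<alpha> {\<tau>0 - \<epsilon> <..< \<tau>0 + \<epsilon>}"
        by (rule B.simple_branch_holomorphic[folded c_def, OF 1(1) _ _ assms(8)]) (use 1 in simp_all)
      ultimately have "concl1" unfolding concl1_def concl_def by blast
      with cs show ?thesis by (simp add: exactly_one_def)
    next
      case 2
      have d2: "d2 = of_real 2 * c ^ n" using g(6) by (simp add: 2(1) d2_def c_def fact_numeral)
      have cs: "\<not> case1" "case2" "\<not> case3" using 2 c0 d2 lower by (simp_all add: case1_def case2_def case3_def)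
      define \<theta> where "\<theta> = Arg d2"
      have arg: "\<theta> = Arg (c ^ n)" unfolding \<theta>_def d2 by (rule Arg_times_of_real) simp
      have \<theta>: "0 \<le> \<theta>" "\<theta> \<le> pi" unfolding arg using 2(2) Arg_less_0 Arg_le_pi by auto
      have polar: "c ^ n = of_real (cmod c ^ n) * cis \<theta>"
        unfolding arg using c0 by (simp add: cis_Arg sgn_div_norm norm_power scaleR_conv_of_real)
      have "c ^ n * cis (of_nat n * ((pi - \<theta>) / 2)) = of_real (cmod c ^ n) * cis (\<theta> + of_nat n * ((pi - \<theta>) / 2))"
        unfolding polar by (simp add: cis_mult mult.assoc)
      also have "\<theta> + of_nat n * ((pi - \<theta>) / 2) = pi" by (simp add: 2(1) field_simps)
      finally have e1: "c ^ n * cis (of_nat n * ((pi - \<theta>) / 2)) = - of_real (cmod c ^ n)" by simp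
      have "c ^ n * cis (of_nat n * ((2 * pi - \<theta>) / 2)) = of_real (cmod c ^ n) * cis (\<theta> + of_nat n * ((2 * pi - \<theta>) / 2))"
        unfolding polar by (simp add: cis_mult mult.assoc)
      also have "\<theta> + of_nat n * ((2 * pi - \<theta>) / 2) = 2 * pi" by (simp add: 2(1) field_simps)
      finally have e2: "c ^ n * cis (of_nat n * ((2 * pi - \<theta>) / 2)) = of_real (cmod c ^ n)" by simp
      have "concl ((pi - \<theta>) / 2) ((2 * pi - \<theta>) / 2)"
      proof (rule branches[OF _ _ e1 _ _ e2])
        show "0 \<le> (pi - \<theta>) / 2" "(2 * pi - \<theta>) / 2 \<le> pi" using \<theta> by simp_all
        have "pi - \<theta> < 2 * pi" "2 * pi - \<theta> > 0" using \<theta> pi_gt_zero by linarith+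
        thus "(pi - \<theta>) / 2 < pi" "0 < (2 * pi - \<theta>) / 2" by simp_all
      qed
      with cs show ?thesis unfolding \<theta>_def by (simp add: exactly_one_def)
    next
      case 3
      have d3: "d3 = 6 * c ^ n" using g(6) by (simp add: 3(1) d3_def c_def fact_numeral)
      have cs: "\<not> case1" "\<not> case2" "case3" using 3 c0 d3 lower lower2 by (simp_all add: case1_def case2_def case3_def)
      have "c ^ n = of_real (Re (c ^ n))" using 3(2) by (simp add: complex_is_Real_iff complex_eq_iff)
      moreover have "Re (c ^ n) = cmod c ^ n" using 3(3) calculation by (metis norm_power norm_of_real abs_of_pos)
      ultimately have polar: "c ^ n = of_real (cmod c ^ n)" by simp
      have "concl (pi / 3) (2 * pi / 3)"
        by (rule branches) (use pi_gt_zero in \<open>simp_all add: 3(1) polar[unfolded 3(1)]\<close>)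
      with cs show ?thesis by (simp add: exactly_one_def)
    qed
  qed
  thus ?thesis
    unfolding Let_def case1_def case2_def case3_def concl1_def concl_def d1_def d2_def d3_def by blast
qed

end
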